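(* Let $a$ be a positive integer and let $r$ be a variable. For any integer $k\geq 2$, we have $$\sum_{n=1}^{k-1}\left((1-2r)^{k-n-1}2^{n-1}\sum_{\mathbf{k}\in I_0(k,n)}t_{2a,a}^r(\mathbf{k})\right)=\sum_{\substack{n+n_1+\cdots+n_m=k-2\\ n,m\geq 0,\ n_1,\ldots,n_m\geq 2}}\frac{2^{n+2m}(2^{n_1-1}-1)\cdots(2^{n_m-1}-1)}{a^k\,n!\,m!\,n_1\cdots n_m(2^{n_1}-1)\cdots(2^{n_m}-1)}\,t(2)\,t(n_1)\cdots t(n_m)\log^n(2).$$
   Context: An index is a finite sequence $\mathbf{k}=(k_1,\ldots,k_n)$ of positive integers. Its weight is $k_1+\cdots+k_n$ and its depth is $\operatorname{dep}(\mathbf{k})=n$. It is admissible if $k_1>1$. For a positive integer $N$, $a\in\{1,\ldots,N\}$ and an admissible index define the multiple $t$-value of level $N$ $$t_{N,a}(\mathbf{k})=\sum_{\substack{m_1>\cdots>m_n>0\\ m_i\equiv a \ (\mathrm{mod}\ N)}}\frac{1}{m_1^{k_1}\cdots m_n^{k_n}}$$ and the interpolated multiple $t$-value of level $N$ $$t_{N,a}^r(\mathbf{k})=\sum_{\mathbf{p}}r^{\,n-\operatorname{dep}(\mathbf{p})}\,t_{N,a}(\mathbf{p}),$$ where $\mathbf{p}$ runs over all $2^{n-1}$ indices obtained from $(k_1\,\Box\, k_2\,\Box\cdots\Box\, k_n)$ by replacing each $\Box$ with either a comma or a plus sign (each choice of replacements counted once). Here the level is $N=2a$. Also $t(n)=t_{2,1}(n)=\sum_{m>0,\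 m\text{ odd}}m^{-n}$ for $n\geq 2$. $I_0(k,n)$ is the set of all admissible indices of weight $k$ and depth $n$. On the right-hand side the sum is over all integers $n,m\geq 0$ and all ordered tuples $(n_1,\ldots,n_m)$ of integers $\geq 2$ satisfying the condition; for $m=0$ the tuple is empty and the products over $n_i$ equal $1$. $\log^n(2)$ means $(\log 2)^n$. *)

theory Defs
  imports "HOL-Analysis.Analysis" "HOL-Number_Theory.Cong"
    "HOL-Computational_Algebra.Polynomial"
begin

definition is_index :: "nat list \<Rightarrow> bool" where
  "is_index ks \<longleftrightarrow> (\<forall>k\<in>set ks. k > 0)"

abbreviation weight :: "nat list \<Rightarrow> nat" where
  "weight ks \<equiv> sum_list ks"

abbreviation dep :: "nat list \<Rightarrow> nat" where
  "dep ks \<equiv> length ks"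

definition admissible :: "nat list \<Rightarrow> bool" where
  "admissible ks \<longleftrightarrow> is_index ks \<and> ks \<noteq> [] \<and> hd ks > 1"

definition I0 :: "nat \<Rightarrow> nat \<Rightarrow> nat list set" where
  "I0 k n = {ks. admissible ks \<and> weight ks = k \<and> dep ks = n}"

definition mtv_domain :: "nat \<Rightarrow> nat \<Rightarrow> nat \<Rightarrow> nat list set" where
  "mtv_domain N a n =
     {ms. length ms = n \<and> sorted_wrt (>) ms \<and> (\<forall>m\<in>set ms. m > 0 \<and> [m = a] (mod N))}"

text \<open>
  Only used for admissible \<open>ks\<close>, where the series of positive terms converges;
  \<^const>\<open>infsum\<close> would return 0 for a divergent one.
\<close>
definition mtv :: "nat \<Rightarrow> nat \<Rightarrow> nat list \<Rightarrow> real" where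
  "mtv N a ks =
     (\<Sum>\<^sub>\<infinity>ms\<in>mtv_domain N a (dep ks). 1 / (\<Prod>i<dep ks. real (ms ! i) ^ (ks ! i)))"

text \<open>
  One list entry for each of the \<open>2 ^ (n - 1)\<close> ways of replacing the boxes:
  the first box becomes a comma (left part) or a plus sign (right part).
\<close>
fun box_choices :: "nat list \<Rightarrow> nat list list" where
  "box_choices [] = [[]]"
| "box_choices [k] = [[k]]"
| "box_choices (k # l # ks) =
     map ((#) k) (box_choices (l # ks)) @ box_choices ((k + l) # ks)"

text \<open>The interpolated value, as a polynomial in the variable \<open>r\<close>.\<close>
definition imtv :: "nat \<Rightarrow> nat \<Rightarrow> nat list \<Rightarrow> real poly" where
  "imtv N a ks = (\<Sum>p\<leftarrow>box_choices ks. monom (mtv N a p) (dep ks - dep p))"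

definition tval :: "nat \<Rightarrow> real" where
  "tval n = mtv 2 1 [n]"

definition rhs_tuples :: "nat \<Rightarrow> (nat \<times> nat \<times> nat list) set" where
  "rhs_tuples w =
     {(n, m, ns). length ns = m \<and> (\<forall>i\<in>set ns. i \<ge> 2) \<and> n + sum_list ns = w}"

end

theory Submission
  imports Defs "HOL-Real_Asymp.Real_Asymp"
begin

unbundle no vec_syntax
unbundle fps_syntax

text \<open>
  Regard \<open>t\<^sup>r\<close> as a sum over \<open>m\<^sub>1 \<ge> m\<^sub>2 \<ge> \<dots>\<close> weighted by \<open>r\<close> to the number of equalities. With the weights
  \<open>(1 - 2r)\<^bsup>k-n-1\<^esup> 2\<^bsup>n-1\<^esup>\<close> each smaller node \<open>l\<close> contributes the factor \<open>(l + x) / (l - x)\<close> to the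
  generating function in the weight, and the largest node \<open>m\<close> contributes \<open>x\<^sup>2 / (m (m - x))\<close>, so \<open>r\<close>
  cancels. For level 2 this leaves \<open>x\<^sup>2 G(x)\<close> with
  \<open>G(x) = \<Sum>m odd. 1 / (m (m - x)) \<Prod>l < m odd. (l + x) / (l - x)\<close>.
  A telescoping certificate gives \<open>(2 - x)\<^sup>2 G(x - 2) = (1 - x)\<^sup>2 G(x)\<close>, and \<open>y G(-y) \<rightarrow> \<pi>/4\<close> as
  \<open>y \<rightarrow> \<infinity>\<close> by Leibniz' series. Iterating the shift expresses \<open>G(x) / G(0)\<close> as an infinite product whose
  logarithm is \<open>2 \<Sum>j. \<eta>(j) x\<^sup>j / j\<close>, where \<open>\<eta>(1) = log 2\<close> and
  \<open>\<eta>(j) = t(j) (2\<^sup>j - 2) / (2\<^sup>j - 1)\<close> for \<open>j \<ge> 2\<close>. Comparing coefficients on both sides gives the claim.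
  It suffices to compare on \<open>(-1, 0]\<close>, where all factors have modulus at most 1.
\<close>

subsection \<open>Generating functions of truncated sums\<close>

fun trunc :: "(nat \<Rightarrow> real) \<Rightarrow> nat list \<Rightarrow> nat \<Rightarrow> real" where
  "trunc u [] M = 1"
| "trunc u (k # ks) M = (\<Sum>j<M. trunc u ks j / u j ^ k)"

text \<open>Expanding every merged entry turns this into a sum over weakly decreasing positions
  below \<open>M\<close> in which each equality of neighbours costs a factor \<rho>. It is the
  truncated value of the polynomial \<open>imtv\<close> at a real point.\<close>

definition itrunc :: "(nat \<Rightarrow> real) \<Rightarrow> real \<Rightarrow> nat list \<Rightarrow> nat \<Rightarrow> real" where
  "itrunc u \<rho> ks M = (\<Sum>p\<leftarrow>box_choices ks. \<rho> ^ (dep ks - dep p) * trunc u p M)"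

lemma trunc_scale: "trunc (\<lambda>j. c * u j) ks M = trunc u ks M / c ^ weight ks"
proof (induction ks arbitrary: M)
  case (Cons k ks)
  then show ?case
    by (simp add: sum_divide_distrib power_add power_mult_distrib mult_ac)
qed simp

lemma trunc_nonneg: "(\<And>j. u j > 0) \<Longrightarrow> 0 \<le> trunc u ks M"
  by (induction ks arbitrary: M) (auto intro!: sum_nonneg divide_nonneg_nonneg simp: less_imp_le)

lemma box_choices_dep: "p \<in> set (box_choices ks) \<Longrightarrow> dep p \<le> dep ks"
proof (induction ks arbitrary: p rule: box_choices.induct)
  case (3 k l ks)
  from "3.prems" consider q where "q \<in> set (box_choices (l # ks))" "p = k # q"
    | "p \<in> set (box_choices ((k + l) # ks))" by auto
  then show ?case
  proof cases
    case (1 q)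
    then show ?thesis using "3.IH"(1)[of q] by simp
  next
    case 2
    then show ?thesis using "3.IH"(2)[of p] by simp
  qed
qed auto

lemma box_choices_weight: "p \<in> set (box_choices ks) \<Longrightarrow> weight p = weight ks"
proof (induction ks arbitrary: p rule: box_choices.induct)
  case (3 k l ks)
  then show ?case by auto
qed auto

lemma box_choices_Cons_index:
  assumes "p \<in> set (box_choices (k # ks))" "is_index (k # ks)"
  shows "is_index p \<and> p \<noteq> [] \<and> k \<le> hd p"
  using assms
proof (induction ks arbitrary: k p)
  case (Cons l ks)
  from Cons.prems(1) consider q where "q \<in> set (box_choices (l # ks))" "p = k # q"
    | "p \<in> set (box_choices ((k + l) # ks))" by auto
  then show ?case
  proof cases
    case (1 q)
    moreover have "is_index (l # ks)" using Cons.prems(2) by (simp add: is_index_def)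
    ultimately have "is_index q" using Cons.IH[of q l] by blast
    then show ?thesis using 1 Cons.prems(2) by (simp add: is_index_def)
  next
    case 2
    moreover have "is_index ((k + l) # ks)" using Cons.prems(2) by (simp add: is_index_def)
    ultimately show ?thesis using Cons.IH[of p "k + l"] by auto
  qed
qed (simp add: is_index_def)

lemma box_choices_admissible:
  assumes "admissible ks" "p \<in> set (box_choices ks)"
  shows "admissible p"
  using assms box_choices_Cons_index[of p "hd ks" "tl ks"] by (cases ks) (auto simp: admissible_def)

lemma itrunc_Nil [simp]: "itrunc u \<rho> [] M = 1"
  by (simp add: itrunc_def)

lemma itrunc_Cons_Cons:
  "itrunc u \<rho> (k # l # ks) M =
     (\<Sum>j<M. itrunc u \<rho> (l # ks) j / u j ^ k) + \<rho> * itrunc u \<rho> ((k + l) # ks) M"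
proof -
  have "(\<Sum>p\<leftarrow>box_choices ((k + l) # ks). \<rho> ^ (dep (k # l # ks) - dep p) * trunc u p M)
      = (\<Sum>p\<leftarrow>box_choices ((k + l) # ks). \<rho> * (\<rho> ^ (dep ((k + l) # ks) - dep p) * trunc u p M))"
    by (intro arg_cong[of _ _ sum_list] map_cong refl)
       (auto dest!: box_choices_dep simp: Suc_diff_le)
  moreover have "(\<Sum>q\<leftarrow>qs. \<rho> ^ (c - dep q) * trunc u (k # q) M)
      = (\<Sum>j<M. (\<Sum>q\<leftarrow>qs. \<rho> ^ (c - dep q) * trunc u q j) / u j ^ k)" for qs c
    by (induction qs) (simp_all add: sum.distrib sum_distrib_left add_divide_distrib)
  ultimately show ?thesis
    by (simp add: itrunc_def sum_list_const_mult o_def del: trunc.simps)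
qed

text \<open>A term is new only if its first position is \<open>M\<close>. The next position is then
  either smaller, which gives \<open>itrunc u \<rho> ks M\<close>, or again \<open>M\<close>, which
  costs \<rho>. In the induction, the merged index with first entry \<open>k + l\<close> carries the
  extra factor \<open>1 / u M ^ k\<close> compared with the one that starts with
  \<open>l\<close>.\<close>

lemma itrunc_step:
  assumes "u M \<noteq> 0"
  shows "itrunc u \<rho> (k # ks) (Suc M) - itrunc u \<rho> (k # ks) M =
     (itrunc u \<rho> ks M + \<rho> * (itrunc u \<rho> ks (Suc M) - itrunc u \<rho> ks M)) / u M ^ k"
proof (induction ks arbitrary: k)
  case Nil
  then show ?case by (simp add: itrunc_def)
next
  case (Cons l ks)
  have "itrunc u \<rho> (k # l # ks) (Suc M) - itrunc u \<rho> (k # l # ks) M =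
      itrunc u \<rho> (l # ks) M / u M ^ k
      + \<rho> * (itrunc u \<rho> ((k + l) # ks) (Suc M) - itrunc u \<rho> ((k + l) # ks) M)"
    by (simp add: itrunc_Cons_Cons algebra_simps)
  also have "itrunc u \<rho> ((k + l) # ks) (Suc M) - itrunc u \<rho> ((k + l) # ks) M
      = (itrunc u \<rho> (l # ks) (Suc M) - itrunc u \<rho> (l # ks) M) / u M ^ k"
    by (simp add: Cons.IH power_add)
  finally show ?case by (simp add: add_divide_distrib)
qed

section \<open>Generating function over all indices of a given weight\<close>

definition compositions :: "nat \<Rightarrow> nat list set" where
  "compositions w = {ks. is_index ks \<and> weight ks = w}"

lemma compositions_0: "compositions 0 = {[]}"
proof -
  have "is_index ks \<Longrightarrow> weight ks = 0 \<Longrightarrow> ks = []" for ks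
    by (cases ks) (auto simp: is_index_def)
  then show ?thesis by (auto simp: compositions_def is_index_def)
qed

lemma compositions_Suc:
  "compositions (Suc w) = (\<Union>k\<in>{1..Suc w}. (#) k ` compositions (Suc w - k))"
proof (intro equalityI subsetI)
  fix ks assume "ks \<in> compositions (Suc w)"
  then show "ks \<in> (\<Union>k\<in>{1..Suc w}. (#) k ` compositions (Suc w - k))"
    by (cases ks) (auto simp: compositions_def is_index_def image_iff)
qed (auto simp: compositions_def is_index_def)

lemma length_le_weight: "is_index ks \<Longrightarrow> dep ks \<le> weight ks"
proof (induction ks)
  case (Cons k ks)
  then show ?case by (auto simp: is_index_def)
qed simp

lemma finite_compositions [simp]: "finite (compositions w)"
proof (induction w rule: less_induct)
  case (less w)
  then show ?case by (cases w) (auto simp: compositions_0 compositions_Suc)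
qed

lemma sum_UN_Cons:
  assumes "finite K" "\<And>k. k \<in> K \<Longrightarrow> finite (A k)"
  shows "sum f (\<Union>k\<in>K. (#) k ` A k) = (\<Sum>k\<in>K. \<Sum>xs\<in>A k. f (k # xs))"
proof -
  have "sum f (\<Union>k\<in>K. (#) k ` A k) = (\<Sum>k\<in>K. sum f ((#) k ` A k))"
    using assms by (intro sum.UNION_disjoint) auto
  then show ?thesis by (simp add: sum.reindex o_def)
qed

lemma sum_compositions_Suc:
  "sum f (compositions (Suc w)) = (\<Sum>k=1..Suc w. \<Sum>ks\<in>compositions (Suc w - k). f (k # ks))"
  unfolding compositions_Suc by (rule sum_UN_Cons) auto

text \<open>The weights of the theorem, spread over the entries: being multiplicative along the
  list, they allow the first entry to be peeled off under the generating function.\<close>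

definition wgt :: "real \<Rightarrow> nat list \<Rightarrow> real" where
  "wgt \<sigma> ks = (\<Prod>k\<leftarrow>ks. 2 * \<sigma> ^ (k - 1))"

lemma wgt_eq: "is_index ks \<Longrightarrow> wgt \<sigma> ks = \<sigma> ^ (weight ks - dep ks) * 2 ^ dep ks"
proof (induction ks)
  case (Cons k ks)
  then have "is_index ks" "k > 0" "dep ks \<le> weight ks"
    using length_le_weight by (auto simp: is_index_def)
  then have "k + weight ks - Suc (dep ks) = (k - 1) + (weight ks - dep ks)" by simp
  with Cons \<open>is_index ks\<close> show ?case by (simp add: wgt_def power_add)
qed (simp add: wgt_def)

definition geo :: "real \<Rightarrow> real fps" where
  "geo c = Abs_fps (\<lambda>i. c ^ i)"

lemma geo_mult: "geo c * (1 - fps_const c * fps_X) = 1"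
proof (rule fps_ext)
  fix n
  have "geo c * (1 - fps_const c * fps_X) = geo c - fps_const c * (fps_X * geo c)"
    by (simp add: right_diff_distrib mult_ac)
  then show "(geo c * (1 - fps_const c * fps_X)) $ n = 1 $ n"
    by (cases n) (simp_all add: geo_def)
qed

text \<open>The product of the factors \<open>(u j + x) / (u j - x)\<close> as a formal series in x;
  for \<open>u = odd_num\<close> its value is \<open>odd_prod\<close>.\<close>

definition pfps :: "(nat \<Rightarrow> real) \<Rightarrow> nat \<Rightarrow> real fps" where
  "pfps u M = (\<Prod>j<M. (1 + fps_const (1 / u j) * fps_X) * geo (1 / u j))"

definition gfps :: "(nat \<Rightarrow> real) \<Rightarrow> nat \<Rightarrow> real fps" where
  "gfps u M = (\<Sum>j<M. fps_const (1 / u j ^ 2) * geo (1 / u j) * pfps u j)"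

definition bfps :: "(nat \<Rightarrow> real) \<Rightarrow> real \<Rightarrow> nat \<Rightarrow> real fps" where
  "bfps u \<rho> M = Abs_fps (\<lambda>w. \<Sum>ks\<in>compositions w. wgt (1 - 2 * \<rho>) ks * itrunc u \<rho> ks M)"

lemma fps_nth_X_mult_conv: "((fps_const c * fps_X) * F) $ w = (if w = 0 then 0 else c * F $ (w - 1))"
  for F :: "real fps"
  by (simp add: mult.assoc)

text \<open>This is where \<rho> disappears. Summing \<open>itrunc_step\<close> over the first entry
  gives a geometric series, hence \<open>e * (1 - \<sigma> Y) = 2 Y (b + \<rho> e)\<close>. Because
  \<open>\<sigma> = 1 - 2 \<rho>\<close>, the terms with \<open>2 \<rho> Y e\<close> on both sides
  cancel.\<close>

lemma bfps_step:
  fixes u M \<rho>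
  defines "Y \<equiv> fps_const (1 / u M) * fps_X" and "\<sigma> \<equiv> 1 - 2 * \<rho>"
    and "b \<equiv> bfps u \<rho> M" and "e \<equiv> bfps u \<rho> (Suc M) - bfps u \<rho> M"
  assumes u: "u M \<noteq> 0"
  shows "e * (1 - Y) = 2 * Y * b"
    and "(1 - Y) * (b + fps_const \<rho> * e) = b * (1 - fps_const \<sigma> * Y)"
proof -
  have e: "e $ w = (\<Sum>ks\<in>compositions w. wgt \<sigma> ks * (itrunc u \<rho> ks (Suc M) - itrunc u \<rho> ks M))" for w
    by (simp add: e_def bfps_def \<sigma>_def sum_subtractf right_diff_distrib)
  have be: "(b + fps_const \<rho> * e) $ w = (\<Sum>ks\<in>compositions w. wgt \<sigma> ks *
      (itrunc u \<rho> ks M + \<rho> * (itrunc u \<rho> ks (Suc M) - itrunc u \<rho> ks M)))" for w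
    by (simp add: e b_def bfps_def \<sigma>_def sum.distrib sum_distrib_left algebra_simps sum_subtractf)
  \<comment> \<open>A first entry \<open>k\<close> sitting at node \<open>M\<close> contributes
    \<open>2 \<sigma>^(k-1) Y^k\<close>; these sum to \<open>2 Y / (1 - \<sigma> Y)\<close>, and
    \<open>?h\<close> collects the remaining entries.\<close>
  have "e = 2 * Y * (geo (\<sigma> / u M) * (b + fps_const \<rho> * e))" (is "_ = 2 * Y * (?g * ?h)")
  proof (rule fps_ext)
    fix w
    show "e $ w = (2 * Y * (geo (\<sigma> / u M) * (b + fps_const \<rho> * e))) $ w"
    proof (cases w)
      case 0
      then show ?thesis by (simp add: e compositions_0 Y_def)
    next
      case (Suc v)
      have "e $ w = (\<Sum>k=1..Suc v. \<Sum>ks\<in>compositions (Suc v - k). wgt \<sigma> (k # ks) *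
              (itrunc u \<rho> (k # ks) (Suc M) - itrunc u \<rho> (k # ks) M))"
        unfolding Suc e sum_compositions_Suc ..
      also have "\<dots> = (\<Sum>k=1..Suc v. 2 * \<sigma> ^ (k - 1) / u M ^ k * (b + fps_const \<rho> * e) $ (Suc v - k))"
        unfolding itrunc_step[where u = u, OF u] be
        by (intro sum.cong refl) (simp add: wgt_def sum_distrib_left mult_ac)
      also have "\<dots> = (\<Sum>k=0..v. 2 * \<sigma> ^ k / u M ^ Suc k * (b + fps_const \<rho> * e) $ (v - k))"
        by (simp only: One_nat_def sum.shift_bounds_cl_Suc_ivl diff_Suc_Suc diff_zero)
      also have "\<dots> = 2 / u M * (geo (\<sigma> / u M) * (b + fps_const \<rho> * e)) $ v"
        unfolding fps_mult_nth
        by (simp add: geo_def sum_distrib_left power_divide field_simps)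
      also have "\<dots> = (2 * Y * (geo (\<sigma> / u M) * (b + fps_const \<rho> * e))) $ w"
      proof -
        have "2 * Y = fps_const (2 / u M) * fps_X"
          by (simp add: Y_def numeral_fps_const flip: mult.assoc)
        then show ?thesis by (simp add: Suc fps_nth_X_mult_conv)
      qed
      finally show ?thesis .
    qed
  qed
  moreover have sY: "fps_const \<sigma> * Y = fps_const (\<sigma> / u M) * fps_X"
    by (simp add: Y_def flip: mult.assoc)
  ultimately have "e * (1 - fps_const \<sigma> * Y) = 2 * Y * (?g * ?h) * (1 - fps_const (\<sigma> / u M) * fps_X)"
    by simp
  also have "\<dots> = 2 * Y * ?h * (?g * (1 - fps_const (\<sigma> / u M) * fps_X))"
    by (simp only: mult_ac)
  finally have "e * (1 - fps_const \<sigma> * Y) = 2 * Y * ?h"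
    unfolding geo_mult by simp
  moreover have "fps_const \<sigma> = 1 - 2 * fps_const \<rho>"
    by (simp add: \<sigma>_def numeral_fps_const fps_const_sub[symmetric] del: fps_const_sub)
  ultimately have "e * (1 - (1 - 2 * fps_const \<rho>) * Y) = 2 * Y * (b + fps_const \<rho> * e)"
    by simp
  then show 1: "e * (1 - Y) = 2 * Y * b"
    by (simp add: algebra_simps)
  have "(1 - Y) * (b + fps_const \<rho> * e) = b * (1 - Y) + fps_const \<rho> * (e * (1 - Y))"
    by (simp add: algebra_simps)
  also have "\<dots> = b * (1 - (1 - 2 * fps_const \<rho>) * Y)"
    unfolding 1 by (simp add: algebra_simps)
  finally show "(1 - Y) * (b + fps_const \<rho> * e) = b * (1 - fps_const \<sigma> * Y)"
    using \<open>fps_const \<sigma> = _\<close> by simp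
qed

text \<open>By the first part of \<open>bfps_step\<close>, adding node \<open>M\<close> multiplies
  the series by \<open>(1 + Y) / (1 - Y)\<close>, whatever \<rho> is.\<close>

lemma bfps_eq_pfps:
  assumes "\<And>j. u j \<noteq> 0"
  shows "bfps u \<rho> M = pfps u M"
proof (induction M)
  case 0
  have z: "itrunc u \<rho> ks 0 = 0" if "ks \<noteq> []" for ks
  proof -
    have "p \<noteq> []" if "p \<in> set (box_choices ks)" for p
      using that \<open>ks \<noteq> []\<close> by (induction ks arbitrary: p rule: box_choices.induct) auto
    then have "trunc u p 0 = 0" if "p \<in> set (box_choices ks)" for p
      using that by (cases p) auto
    then show ?thesis by (simp add: itrunc_def cong: map_cong)
  qed
  show ?case
  proof (rule fps_ext)
    fix w show "bfps u \<rho> 0 $ w = pfps u 0 $ w"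
    proof (cases w)
      case (Suc v)
      then have "ks \<in> compositions w \<Longrightarrow> ks \<noteq> []" for ks by (auto simp: compositions_def)
      then show ?thesis by (simp add: bfps_def pfps_def z Suc)
    qed (simp add: bfps_def pfps_def compositions_0 wgt_def)
  qed
next
  case (Suc M)
  let ?Y = "fps_const (1 / u M) * fps_X"
  from bfps_step(1)[of u M \<rho>] assms
  have "bfps u \<rho> (Suc M) * (1 - ?Y) = bfps u \<rho> M * (1 + ?Y)"
    by (simp add: algebra_simps)
  then have "geo (1 / u M) * (bfps u \<rho> (Suc M) * (1 - ?Y)) = geo (1 / u M) * (bfps u \<rho> M * (1 + ?Y))"
    by simp
  then have "bfps u \<rho> (Suc M) * (geo (1 / u M) * (1 - ?Y)) = bfps u \<rho> M * ((1 + ?Y) * geo (1 / u M))"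
    by (simp only: mult_ac)
  then have "bfps u \<rho> (Suc M) = bfps u \<rho> M * ((1 + ?Y) * geo (1 / u M))"
    unfolding geo_mult by simp
  then show ?case by (simp add: Suc pfps_def)
qed

section \<open>Truncated sums over indices with first entry at least 2\<close>

lemma sum_shift_2: "(\<Sum>k=2..w+2. f k) = (\<Sum>k=0..w. f (k + 2))" for w :: nat
  using sum.shift_bounds_cl_nat_ivl[of f 0 2 w] by (simp only: add_0)

lemma geo_mult_nth: "(fps_const c * (geo s * H)) $ w = (\<Sum>k=0..w. c * s ^ k * H $ (w - k))"
  by (simp add: fps_mult_nth[of "geo s"] sum_distrib_left mult.assoc) (simp add: geo_def)

text \<open>The first entry \<open>k\<close> carries \<sigma>^(k-2) without the factor 2, so the
  increment at node \<open>M\<close> is \<open>u M ^ -2\<close> times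
  \<open>(b + \<rho> e) / (1 - \<sigma> Y)\<close>. The second part of \<open>bfps_step\<close>
  turns this quotient into \<open>b / (1 - Y)\<close>, which is free of \<rho>.\<close>

lemma truncated_sum:
  assumes u: "\<And>j. u j \<noteq> 0"
  shows "(\<Sum>k=2..w+2. (1 - 2 * \<rho>) ^ (k - 2) *
           (\<Sum>ks\<in>compositions (w + 2 - k). wgt (1 - 2 * \<rho>) ks * itrunc u \<rho> (k # ks) M))
         = gfps u M $ w"
proof (induction M)
  case 0
  have "itrunc u \<rho> (k # ks) 0 = 0" for k ks
  proof -
    have "p \<noteq> []" if "p \<in> set (box_choices (k # ks))" for p
      using that by (induction "k # ks" arbitrary: k ks p rule: box_choices.induct) auto
    then have "trunc u p 0 = 0" if "p \<in> set (box_choices (k # ks))" for p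
      using that by (cases p) auto
    then show ?thesis by (simp add: itrunc_def cong: map_cong)
  qed
  then show ?case by (simp add: gfps_def)
next
  case (Suc M)
  let ?s = "1 - 2 * \<rho>" and ?Y = "fps_const (1 / u M) * fps_X"
  let ?b = "bfps u \<rho> M" and ?e = "bfps u \<rho> (Suc M) - bfps u \<rho> M"
  let ?h = "?b + fps_const \<rho> * ?e"
  have h: "?h $ v = (\<Sum>ks\<in>compositions v. wgt ?s ks *
      (itrunc u \<rho> ks M + \<rho> * (itrunc u \<rho> ks (Suc M) - itrunc u \<rho> ks M)))" for v
    by (simp add: bfps_def sum.distrib sum_distrib_left algebra_simps sum_subtractf)
  have "(\<Sum>k=2..w+2. ?s ^ (k - 2) *
           (\<Sum>ks\<in>compositions (w + 2 - k). wgt ?s ks * itrunc u \<rho> (k # ks) (Suc M)))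
      - (\<Sum>k=2..w+2. ?s ^ (k - 2) *
           (\<Sum>ks\<in>compositions (w + 2 - k). wgt ?s ks * itrunc u \<rho> (k # ks) M))
      = (\<Sum>k=2..w+2. ?s ^ (k - 2) *
           (\<Sum>ks\<in>compositions (w + 2 - k). wgt ?s ks * 
             (itrunc u \<rho> (k # ks) (Suc M) - itrunc u \<rho> (k # ks) M)))"
    by (simp add: sum_subtractf right_diff_distrib)
  also have "\<dots> = (\<Sum>k=2..w+2. ?s ^ (k - 2) / u M ^ k * ?h $ (w + 2 - k))"
    unfolding itrunc_step[where u = u, OF u] h by (intro sum.cong refl) (simp add: sum_distrib_left mult_ac)
  also have "\<dots> = (\<Sum>k=0..w. ?s ^ k / u M ^ (k + 2) * ?h $ (w - k))"
    unfolding sum_shift_2 by (simp del: power_Suc)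
  also have "\<dots> = (fps_const (1 / u M ^ 2) * (geo (?s / u M) * ?h)) $ w"
    unfolding geo_mult_nth by (simp add: power_divide power_add mult_ac power2_eq_square)
  \<comment> \<open>Cross-multiplied form of \<open>bfps_step(2)\<close>: both denominators
    \<open>1 - Y\<close> and \<open>1 - \<sigma> Y\<close> are inverted by their geometric
    series.\<close>
  also have "geo (?s / u M) * ?h = geo (1 / u M) * ?b"
  proof -
    have "geo (1 / u M) * ((1 - ?Y) * ?h) * geo (?s / u M)
        = geo (1 / u M) * (?b * (1 - fps_const ?s * ?Y)) * geo (?s / u M)"
      using bfps_step(2)[of u M \<rho>] u by simp
    moreover have "fps_const ?s * ?Y = fps_const (?s / u M) * fps_X"
      by (simp flip: mult.assoc)
    ultimately have "(geo (1 / u M) * (1 - ?Y)) * ?h * geo (?s / u M)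
        = (geo (?s / u M) * (1 - fps_const (?s / u M) * fps_X)) * (geo (1 / u M) * ?b)"
      by (simp only: mult_ac)
    then show ?thesis unfolding geo_mult by (simp add: mult.commute)
  qed
  finally show ?case
    using Suc.IH by (simp add: gfps_def bfps_eq_pfps[OF u] mult.assoc)
qed

subsection \<open>The shift relation and asymptotics\<close>

abbreviation odd_num :: "nat \<Rightarrow> real" where "odd_num j \<equiv> 2 * real j + 1"

definition odd_prod :: "real \<Rightarrow> nat \<Rightarrow> real" where
  "odd_prod x j = (\<Prod>l<j. (odd_num l + x) / (odd_num l - x))"

definition odd_term :: "real \<Rightarrow> nat \<Rightarrow> real" where
  "odd_term x j = odd_prod x j / (odd_num j * (odd_num j - x))"

definition odd_series :: "real \<Rightarrow> real" where
  "odd_series x = (\<Sum>j. odd_term x j)"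

lemma odd_prod_0 [simp]: "odd_prod x 0 = 1"
  and odd_prod_Suc: "odd_prod x (Suc j) = odd_prod x j * ((odd_num j + x) / (odd_num j - x))"
  by (simp_all add: odd_prod_def)

lemma odd_prod_factor_le_1: "x \<le> 0 \<Longrightarrow> \<bar>(odd_num l + x) / (odd_num l - x)\<bar> \<le> 1"
  by (simp add: abs_le_iff field_simps)

lemma abs_odd_prod_le_1: "x \<le> 0 \<Longrightarrow> \<bar>odd_prod x j\<bar> \<le> 1"
  unfolding odd_prod_def abs_prod by (intro prod_le_1 conjI odd_prod_factor_le_1) auto

lemma summable_odd_num_squares: "summable (\<lambda>j. 1 / odd_num j ^ 2)"
proof (rule summable_comparison_test')
  show "summable (\<lambda>j. 1 / real (Suc j) ^ 2)"
    using inverse_power_summable[of 2] by (subst summable_Suc_iff) (simp add: field_simps)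
  show "norm (1 / odd_num j ^ 2) \<le> 1 / real (Suc j) ^ 2" if "j \<ge> 0" for j
    by (auto intro!: divide_left_mono power_mono mult_pos_pos)
qed

lemma abs_odd_term_le:
  assumes "x \<le> 0"
  shows "\<bar>odd_term x j\<bar> \<le> 1 / odd_num j ^ 2"
proof -
  have "odd_num j ^ 2 \<le> odd_num j * (odd_num j - x)"
    unfolding power2_eq_square using assms by (intro mult_left_mono) auto
  then have "\<bar>odd_prod x j\<bar> / \<bar>odd_num j * (odd_num j - x)\<bar> \<le> 1 / odd_num j ^ 2"
    using assms abs_odd_prod_le_1[OF assms, of j] by (intro frac_le) auto
  then show ?thesis by (simp add: odd_term_def)
qed

lemma summable_abs_odd_term: "x \<le> 0 \<Longrightarrow> summable (\<lambda>j. \<bar>odd_term x j\<bar>)"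
  using abs_odd_term_le by (intro summable_comparison_test'[OF summable_odd_num_squares]) auto

lemma summable_odd_term: "x \<le> 0 \<Longrightarrow> summable (odd_term x)"
  using summable_abs_odd_term summable_rabs_cancel by blast

lemma sum_odd_term_le:
  assumes "x \<le> 0"
  shows "(\<Sum>j<M. odd_term x j) \<le> (\<Sum>j. 1 / odd_num j ^ 2)"
proof -
  have "(\<Sum>j<M. odd_term x j) \<le> (\<Sum>j<M. 1 / odd_num j ^ 2)"
    using abs_odd_term_le[OF assms] by (intro sum_mono) (simp add: abs_le_iff)
  also have "\<dots> \<le> (\<Sum>j. 1 / odd_num j ^ 2)"
    by (intro sum_le_suminf summable_odd_num_squares) auto
  finally show ?thesis .
qed

text \<open>Replacing x by \<open>x - 2\<close> moves every numerator one node down and every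
  denominator one node up, so the two products differ only in their end factors. The second
  hypothesis keeps the new denominator \<open>odd_num j - 2 + x\<close> away from 0 for positive
  \<open>j\<close>.\<close>

lemma odd_prod_shift:
  assumes "x < 1" "\<And>j. odd_num j + x \<noteq> 0"
  shows "odd_prod (x - 2) j = - odd_prod x j * (1 - x) ^ 2 / ((odd_num j - 2 + x) * (odd_num j - x))"
proof (induction j)
  case 0
  have "x - 1 \<noteq> 0" "1 - x \<noteq> 0" using assms(1) by auto
  then show ?case by (simp add: power2_eq_square divide_simps)
next
  case (Suc j)
  have nz: "odd_num j - 2 + x \<noteq> 0"
  proof (cases j)
    case (Suc i)
    then show ?thesis using assms(2)[of i] by (simp add: algebra_simps)
  qed (use assms(1) in auto)
  define m where "m = odd_num j"
  have m: "m - x \<noteq> 0" "m - x + 2 \<noteq> 0" "m + x \<noteq> 0" "m - 2 + x \<noteq> 0" "odd_num (Suc j) = m + 2"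
    using assms(1) assms(2)[of j] nz by (auto simp: m_def)
  have "odd_prod (x - 2) (Suc j) = - odd_prod x j * (1 - x) ^ 2 / ((m - 2 + x) * (m - x)) * ((m - 2 + x) / (m - x + 2))"
    by (simp add: odd_prod_Suc Suc m_def algebra_simps)
  also have "\<dots> = - (odd_prod x j * ((m + x) / (m - x))) * (1 - x) ^ 2 / ((m + 2 - 2 + x) * (m + 2 - x))"
    using m by (simp add: divide_simps)
  finally show ?case unfolding odd_prod_Suc m(5) by (simp add: m_def)
qed

text \<open>Zeilberger's certificate for the shift \<open>x \<mapsto> x - 2\<close>.\<close>
definition cert :: "real \<Rightarrow> nat \<Rightarrow> real" where
  "cert x j = (1 - x) / 2 * (odd_num j - 1) * odd_prod x j / ((odd_num j - 2 + x) * (odd_num j - x))"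

text \<open>After \<open>odd_prod_shift\<close> all four terms are multiples of
  \<open>odd_prod x j\<close>, and what remains is an identity of rational functions in
  \<open>odd_num j\<close> and x.\<close>

lemma cert_step:
  assumes "x < 1" "\<And>j. odd_num j + x \<noteq> 0"
  shows "(2 - x) ^ 2 * odd_term (x - 2) j - (1 - x) ^ 2 * odd_term x j = cert x (Suc j) - cert x j"
proof -
  have nz: "odd_num j - 2 + x \<noteq> 0"
  proof (cases j)
    case (Suc i)
    then show ?thesis using assms(2)[of i] by (simp add: algebra_simps)
  qed (use assms(1) in auto)
  define m where "m = odd_num j"
  define P where "P = odd_prod x j"
  have m: "m \<noteq> 0" "m - x \<noteq> 0" "m + 2 - x \<noteq> 0" "m + x \<noteq> 0" "m - 2 + x \<noteq> 0" "odd_num (Suc j) = m + 2"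
    using assms(1) assms(2)[of j] nz by (auto simp: m_def)
  have "(2 - x) ^ 2 * odd_term (x - 2) j = (2 - x) ^ 2 * (- P * (1 - x) ^ 2 / ((m - 2 + x) * (m - x)) / (m * (m + 2 - x)))"
    by (simp add: odd_term_def odd_prod_shift[OF assms] m_def P_def algebra_simps)
  moreover have "odd_term x j = P / (m * (m - x))"
    by (simp add: odd_term_def m_def P_def)
  moreover have "cert x j = (1 - x) / 2 * (m - 1) * P / ((m - 2 + x) * (m - x))"
    by (simp add: cert_def m_def P_def)
  moreover have "cert x (Suc j) = (1 - x) / 2 * (m + 1) * P / ((m - x) * (m + 2 - x))"
  proof -
    have "cert x (Suc j) = (1 - x) / 2 * (m + 1) * (P * ((m + x) / (m - x))) / ((m + x) * (m + 2 - x))"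
    proof -
      have "odd_prod x (Suc j) = P * ((m + x) / (m - x))"
        by (simp add: odd_prod_Suc m_def P_def)
      then show ?thesis unfolding cert_def m(6) by simp
    qed
    then show ?thesis using m(1-5) by (simp add: divide_simps) (simp add: algebra_simps)
  qed
  moreover have "(2 - x) ^ 2 * (- P * (1 - x) ^ 2 / ((m - 2 + x) * (m - x)) / (m * (m + 2 - x)))
     - (1 - x) ^ 2 * (P / (m * (m - x))) = (1 - x) / 2 * (m + 1) * P / ((m - x) * (m + 2 - x))
      - (1 - x) / 2 * (m - 1) * P / ((m - 2 + x) * (m - x))"
    using m(1-5) by (simp add: divide_simps) algebra
  ultimately show ?thesis by metis
qed

lemma sum_cert:
  assumes "x < 1" "\<And>j. odd_num j + x \<noteq> 0"
  shows "(2 - x) ^ 2 * (\<Sum>j<M. odd_term (x - 2) j) - (1 - x) ^ 2 * (\<Sum>j<M. odd_term x j) = cert x M"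
proof -
  have "(2 - x) ^ 2 * (\<Sum>j<M. odd_term (x - 2) j) - (1 - x) ^ 2 * (\<Sum>j<M. odd_term x j)
      = (\<Sum>j<M. cert x (Suc j) - cert x j)"
    by (simp add: sum_distrib_left cert_step[OF assms] flip: sum_subtractf)
  also have "\<dots> = cert x M"
    \<comment> \<open>The lower end vanishes because \<open>cert x 0\<close> contains the factor
      \<open>odd_num 0 - 1\<close>.\<close>
    by (subst sum_lessThan_telescope) (simp add: cert_def)
  finally show ?thesis .
qed

text \<open>For \<open>0 < x < 1\<close> the certificate is nonnegative, so the shift relation bounds the partial sums.\<close>
lemma sum_odd_term_bounded:
  assumes "0 < x" "x < 1"
  obtains B where "\<And>M. (\<Sum>j<M. odd_term x j) \<le> B"
proof
  fix M
  have "cert x M \<ge> 0"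
  proof (cases M)
    case (Suc i)
    have "odd_prod x M \<ge> 0" unfolding odd_prod_def using assms by (intro prod_nonneg) auto
    then show ?thesis using assms Suc by (auto simp: cert_def intro!: divide_nonneg_pos mult_nonneg_nonneg mult_pos_pos)
  qed (simp add: cert_def)
  moreover have "odd_num j + x \<noteq> 0" for j using assms by (smt (verit) of_nat_0_le_iff)
  ultimately have "(1 - x) ^ 2 * (\<Sum>j<M. odd_term x j) \<le> (2 - x) ^ 2 * (\<Sum>j<M. odd_term (x - 2) j)"
    using sum_cert[of x M] assms by linarith
  also have "\<dots> \<le> (2 - x) ^ 2 * (\<Sum>j. 1 / odd_num j ^ 2)"
    using assms by (intro mult_left_mono sum_odd_term_le) auto
  finally show "(\<Sum>j<M. odd_term x j) \<le> (2 - x) ^ 2 * (\<Sum>j. 1 / odd_num j ^ 2) / (1 - x) ^ 2"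
    using assms by (simp add: field_simps)
qed

text \<open>For nonpositive x the products have modulus at most 1, so \<open>cert x M\<close> is of
  order \<open>1 / M\<close> and the telescoped identity passes to the limit.\<close>

lemma odd_series_shift:
  assumes "x \<le> 0" "\<And>j. odd_num j + x \<noteq> 0"
  shows "(2 - x) ^ 2 * odd_series (x - 2) = (1 - x) ^ 2 * odd_series x"
proof -
  have "(\<lambda>M. (1 - x) / 2 * (odd_num M - 1) / ((odd_num M - 2 + x) * (odd_num M - x))) \<longlonglongrightarrow> 0"
    by real_asymp
  then have "(\<lambda>M. \<bar>(1 - x) / 2 * (odd_num M - 1) / ((odd_num M - 2 + x) * (odd_num M - x))\<bar>) \<longlonglongrightarrow> 0"
    by (rule tendsto_rabs_zero)
  then have "cert x \<longlonglongrightarrow> 0"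
  proof (rule Lim_null_comparison[rotated], intro always_eventually allI)
    fix M
    have "norm (cert x M) = \<bar>(1 - x) / 2 * (odd_num M - 1) / ((odd_num M - 2 + x) * (odd_num M - x))\<bar> * \<bar>odd_prod x M\<bar>"
      by (simp add: cert_def abs_mult)
    also have "\<dots> \<le> \<bar>(1 - x) / 2 * (odd_num M - 1) / ((odd_num M - 2 + x) * (odd_num M - x))\<bar> * 1"
      using abs_odd_prod_le_1[OF assms(1)] by (intro mult_left_mono) auto
    finally show "norm (cert x M) \<le> \<bar>(1 - x) / 2 * (odd_num M - 1) / ((odd_num M - 2 + x) * (odd_num M - x))\<bar>"
      by simp
  qed
  moreover have "(\<lambda>M. (2 - x) ^ 2 * (\<Sum>j<M. odd_term (x - 2) j) - (1 - x) ^ 2 * (\<Sum>j<M. odd_term x j))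
      \<longlonglongrightarrow> (2 - x) ^ 2 * odd_series (x - 2) - (1 - x) ^ 2 * odd_series x"
    unfolding odd_series_def using assms(1) by (intro tendsto_intros summable_LIMSEQ summable_odd_term) auto
  ultimately show ?thesis
    using assms LIMSEQ_unique unfolding sum_cert[of x, OF _ assms(2), simplified] 
    by (smt (verit) sum_cert tendsto_cong always_eventually)
qed

lemma odd_series_iterate:
  assumes "-1 < x" "x \<le> 0"
  shows "odd_series x = (\<Prod>i<p. ((2 * real i + 2 - x) / (2 * real i + 1 - x)) ^ 2) * odd_series (x - 2 * real p)"
proof (induction p)
  case (Suc p)
  let ?x = "x - 2 * real p"
  \<comment> \<open>A zero would make x an odd integer, and there is none in (-1, 0].\<close>
  have "odd_num j + ?x \<noteq> 0" for j
  proof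
    assume "odd_num j + ?x = 0"
    then have "x = of_int (2 * int p - 2 * int j - 1)" by simp
    then show False using assms by simp
  qed
  then have "(2 - ?x) ^ 2 * odd_series (?x - 2) = (1 - ?x) ^ 2 * odd_series ?x"
    using assms by (intro odd_series_shift) auto
  moreover have "1 - ?x > 0" using assms by simp
  ultimately have "odd_series ?x = ((2 - ?x) / (1 - ?x)) ^ 2 * odd_series (?x - 2)"
    by (simp add: field_simps)
  with Suc show ?case by (simp add: algebra_simps)
qed simp

section \<open>Behaviour of \<open>odd_series\<close> towards minus infinity\<close>

lemma alternating_sum_bounds:
  fixes c :: "nat \<Rightarrow> real"
  assumes "\<And>i. c (Suc i) \<le> c i" "\<And>i. 0 \<le> c i"
  shows "0 \<le> (\<Sum>i<d. (-1) ^ i * c (N + i)) \<and> (\<Sum>i<d. (-1) ^ i * c (N + i)) \<le> c N"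
proof (induction d arbitrary: N)
  case (Suc d)
  have "(\<Sum>i<Suc d. (-1) ^ i * c (N + i)) = c N - (\<Sum>i<d. (-1) ^ i * c (Suc N + i))"
    unfolding sum.lessThan_Suc_shift by (simp add: sum_negf)
  with Suc[of "Suc N"] assms(1)[of N] show ?case by linarith
qed (use assms in simp)

text \<open>The limits of the terms form Leibniz' series, which converges only conditionally, so no
  summable majorant exists. This bound, uniform in y and \<open>M\<close>, takes its place: signs
  alternate while the nodes stay below y, and from there on the product is so small that absolute
  estimates suffice.\<close>

lemma odd_term_tail_le:
  assumes y: "y > odd_num N" and "N \<le> M"
  shows "\<bar>\<Sum>j=N..<M. y * odd_term (- y) j\<bar> \<le> 1 / odd_num N + 2 * (\<Sum>j. 1 / odd_num (j + N) ^ 2)"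
proof -
  have y0: "y > 0" using y by (smt (verit) of_nat_0_le_iff)
  define c where "c j = y * (\<bar>odd_prod (- y) j\<bar> / (odd_num j * (odd_num j + y)))" for j
  \<comment> \<open>The first position whose node reaches y: the factors of
    \<open>odd_prod (- y)\<close> are negative before \<open>K\<close> and nonnegative from
    \<open>K\<close> on.\<close>
  define K where "K = (LEAST k. y \<le> odd_num k)"
  have "\<exists>k. y \<le> odd_num k" using real_arch_simple[of y] by (smt (verit) of_nat_0_le_iff)
  then have yK: "y \<le> odd_num K" unfolding K_def by (rule LeastI_ex)
  have less_K: "odd_num k < y" if "k < K" for k
    using not_less_Least[of k "\<lambda>k. y \<le> odd_num k"] that by (simp add: K_def)
  have NK: "N < K" using yK y by simp
  have c_le: "c j \<le> y / odd_num j ^ 2 * \<bar>odd_prod (- y) j\<bar>" for j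
  proof -
    have "\<bar>odd_prod (- y) j\<bar> / (odd_num j * (odd_num j + y)) \<le> \<bar>odd_prod (- y) j\<bar> / odd_num j ^ 2"
      unfolding power2_eq_square using y0 by (intro divide_left_mono mult_left_mono mult_pos_pos) (auto intro: add_pos_pos)
    from mult_left_mono[OF this, of y] show ?thesis using y0 by (simp add: c_def)
  qed
  have c_N: "c N \<le> 1 / odd_num N"
  proof -
    have "c N \<le> y * (1 / (odd_num N * (odd_num N + y)))"
      unfolding c_def using y0 abs_odd_prod_le_1[of "- y" N] by (intro mult_left_mono divide_right_mono) auto
    also have "\<dots> = 1 / odd_num N * (y / (odd_num N + y))" by simp
    also have "\<dots> \<le> 1 / odd_num N * 1"
      using y0 by (intro mult_left_mono) (auto simp: field_simps)
    finally show ?thesis by simp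
  qed
  have c_nonneg: "0 \<le> c j" for j using y0 by (simp add: c_def)
  have "c (Suc i) \<le> c i" for i
  proof -
    have "\<bar>odd_prod (- y) (Suc i)\<bar> \<le> \<bar>odd_prod (- y) i\<bar> * 1"
      unfolding odd_prod_Suc abs_mult using y0 by (intro mult_left_mono odd_prod_factor_le_1) auto
    then show ?thesis unfolding c_def using y0
      by (intro mult_left_mono frac_le mult_mono mult_pos_pos) (auto intro: add_pos_pos)
  qed
  note c = this c_nonneg
  have sgn: "odd_prod (- y) j = (-1) ^ j * \<bar>odd_prod (- y) j\<bar>" if "j \<le> K" for j
    using that
  proof (induction j)
    case (Suc j)
    have "(odd_num j + - y) / (odd_num j - - y) = - \<bar>(odd_num j + - y) / (odd_num j - - y)\<bar>"
      using less_K[of j] Suc.prems y0 by (simp add: abs_if field_simps)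
    then have "odd_prod (- y) (Suc j) = ((-1) ^ j * \<bar>odd_prod (- y) j\<bar>) * (- \<bar>(odd_num j + - y) / (odd_num j - - y)\<bar>)"
      unfolding odd_prod_Suc using Suc by (intro arg_cong2[of _ _ _ _ "(*)"]) auto
    also have "\<dots> = (-1) ^ Suc j * \<bar>odd_prod (- y) (Suc j)\<bar>"
      unfolding odd_prod_Suc abs_mult by simp
    finally show ?case .
  qed simp
  \<comment> \<open>Up to \<open>K\<close> the terms alternate in sign and decrease in modulus, so
    the block is bounded by its first term.\<close>
  have first: "\<bar>\<Sum>j=N..<L. y * odd_term (- y) j\<bar> \<le> c N" if "L \<le> K" "N \<le> L" for L
  proof -
    have "(\<Sum>j=N..<L. y * odd_term (- y) j) = (\<Sum>j=N..<L. (-1) ^ j * c j)"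
    proof (intro sum.cong refl)
      fix j assume "j \<in> {N..<L}"
      then have "odd_prod (- y) j = (-1) ^ j * \<bar>odd_prod (- y) j\<bar>" using that by (intro sgn) auto
      from arg_cong[OF this, of "\<lambda>t. y * (t / (odd_num j * (odd_num j + y)))"]
      show "y * odd_term (- y) j = (-1) ^ j * c j" by (simp add: odd_term_def c_def mult_ac)
    qed
    also have "\<dots> = (\<Sum>i<L - N. (-1) ^ (N + i) * c (N + i))"
      using that by (intro sum.reindex_bij_witness[of _ "\<lambda>i. N + i" "\<lambda>j. j - N"]) auto
    also have "\<dots> = (-1) ^ N * (\<Sum>i<L - N. (-1) ^ i * c (N + i))"
      by (simp add: sum_distrib_left power_add mult.assoc)
    finally show ?thesis using alternating_sum_bounds[of c N "L - N", OF c]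
      by (simp add: abs_mult)
  qed
  have sumt: "summable (\<lambda>j. 1 / odd_num (j + N) ^ 2)"
    using summable_odd_num_squares by (subst summable_iff_shift)
  show ?thesis
  proof (cases "M \<le> K")
    case True
    moreover have "0 \<le> (\<Sum>j. 1 / odd_num (j + N) ^ 2)" by (intro suminf_nonneg sumt) simp
    ultimately show ?thesis using first[of M] assms(2) c_N by linarith
  next
    case False
    then obtain K' where K': "K = Suc K'" using NK by (cases K) auto
    \<comment> \<open>The last node before \<open>K\<close> differs from y by at most 2, so its
      factor alone is at most \<open>2 / y\<close>; all other factors have modulus at most 1. This
      cancels the y in front of the terms.\<close>
    have odd_prod_le: "\<bar>odd_prod (- y) j\<bar> \<le> 2 / y" if "K \<le> j" for j
      using that
    proof (induction j rule: dec_induct)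
      case base
      have "odd_num K' < y" "y \<le> odd_num K' + 2" using less_K[of K'] yK K' by auto
      then have "\<bar>(odd_num K' + - y) / (odd_num K' - - y)\<bar> \<le> 2 / y"
        using y0 by (subst abs_divide, intro frac_le) auto
      then have "\<bar>odd_prod (- y) K'\<bar> * \<bar>(odd_num K' + - y) / (odd_num K' - - y)\<bar> \<le> 1 * (2 / y)"
        using y0 abs_odd_prod_le_1[of "- y"] by (intro mult_mono) auto
      then show ?case unfolding K' odd_prod_Suc abs_mult by simp
    next
      case (step j)
      have "\<bar>odd_prod (- y) (Suc j)\<bar> \<le> \<bar>odd_prod (- y) j\<bar> * 1"
        unfolding odd_prod_Suc abs_mult using y0 by (intro mult_left_mono odd_prod_factor_le_1) auto
      then show ?case using step by simp
    qed
    have "\<bar>\<Sum>j=K..<M. y * odd_term (- y) j\<bar> \<le> (\<Sum>j=K..<M. c j)"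
      using y0 by (intro order.trans[OF sum_abs] sum_mono) (simp add: odd_term_def c_def abs_mult add.commute)
    also have "\<dots> \<le> (\<Sum>j=K..<M. 2 / odd_num j ^ 2)"
    proof (intro sum_mono)
      fix j assume "j \<in> {K..<M}"
      then have "c j \<le> y / odd_num j ^ 2 * (2 / y)"
        using c_le[of j] odd_prod_le[of j] y0 by (smt (verit) atLeastLessThan_iff divide_nonneg_nonneg mult_left_mono zero_le_power2)
      then show "c j \<le> 2 / odd_num j ^ 2" using y0 by simp
    qed
    also have "\<dots> \<le> (\<Sum>j=N..<M. 2 / odd_num j ^ 2)"
      using NK by (intro sum_mono2) auto
    also have "\<dots> = 2 * (\<Sum>i<M - N. 1 / odd_num (i + N) ^ 2)"
      unfolding sum_distrib_left
      by (intro sum.reindex_bij_witness[of _ "\<lambda>i. i + N" "\<lambda>j. j - N"]) auto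
    also have "\<dots> \<le> 2 * (\<Sum>j. 1 / odd_num (j + N) ^ 2)"
      by (intro mult_left_mono sum_le_suminf sumt) auto
    finally have "\<bar>\<Sum>j=K..<M. y * odd_term (- y) j\<bar> \<le> 2 * (\<Sum>j. 1 / odd_num (j + N) ^ 2)" .
    moreover have "(\<Sum>j=N..<M. y * odd_term (- y) j) = (\<Sum>j=N..<K. y * odd_term (- y) j) + (\<Sum>j=K..<M. y * odd_term (- y) j)"
      using NK False by (intro sum.atLeastLessThan_concat[symmetric]) auto
    ultimately show ?thesis using first[of K] NK c_N by linarith
  qed
qed

text \<open>Each \<open>y * odd_term (- y) j\<close> tends to \<open>(-1) ^ j / odd_num j\<close>.
  The position \<open>N\<close> is fixed first, making the uniform tail bound and the remainder of
  Leibniz' series small; then y grows and only the finite head has to converge.\<close>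

lemma odd_series_asymptotic: "((\<lambda>y. y * odd_series (- y)) \<longlongrightarrow> pi / 4) at_top"
proof (rule tendstoI)
  fix e :: real assume e: "e > 0"
  define err where "err N = 1 / odd_num N + 2 * (\<Sum>j. 1 / odd_num (j + N) ^ 2)" for N
  have "(\<lambda>N. 1 / odd_num N) \<longlonglongrightarrow> 0" by real_asymp
  moreover have "(\<lambda>N. \<Sum>j. 1 / odd_num (j + N) ^ 2) \<longlonglongrightarrow> 0"
    by (rule suminf_exist_split2) (rule summable_odd_num_squares)
  ultimately have "err \<longlonglongrightarrow> 0 + 2 * 0"
    unfolding err_def by (intro tendsto_intros)
  then have "eventually (\<lambda>N. \<bar>err N\<bar> < e / 3) sequentially"
    using e by (auto simp: tendsto_iff dist_real_def dest!: spec[of _ "e / 3"])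
  moreover have "(\<lambda>N. \<Sum>j<N. (-1) ^ j / odd_num j) \<longlonglongrightarrow> pi / 4"
  proof -
    have "summable (\<lambda>k. (-1) ^ k * (1 / real (k * 2 + 1) * 1 ^ (k * 2 + 1)) :: real)"
      by (rule summable_arctan_series) simp
    then have "(\<lambda>k. (-1) ^ k * 1 / real (k * 2 + 1)) sums (pi / 4)"
      unfolding pi_series by (intro summable_sums) simp
    then show ?thesis by (simp add: sums_def mult.commute add.commute)
  qed
  then have "eventually (\<lambda>N. dist (\<Sum>j<N. (-1) ^ j / odd_num j) (pi / 4) < e / 3) sequentially"
    using e by (intro tendstoD) auto
  ultimately have "eventually (\<lambda>N. \<bar>err N\<bar> < e / 3 \<and> dist (\<Sum>j<N. (-1) ^ j / odd_num j) (pi / 4) < e / 3) sequentially"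
    by (rule eventually_conj)
  then obtain N where N: "\<bar>err N\<bar> < e / 3" "dist (\<Sum>j<N. (-1) ^ j / odd_num j) (pi / 4) < e / 3"
    by (auto simp: eventually_sequentially)
  have "((\<lambda>y. \<Sum>j<N. y * odd_term (- y) j) \<longlongrightarrow> (\<Sum>j<N. (-1) ^ j / odd_num j)) at_top"
  proof (intro tendsto_sum)
    fix j
    have "((\<lambda>y. odd_prod (- y) j) \<longlongrightarrow> (\<Prod>l<j. -1)) at_top"
      unfolding odd_prod_def by (intro tendsto_prod) real_asymp
    moreover have "((\<lambda>y. y / (odd_num j * (odd_num j - - y))) \<longlongrightarrow> 1 / odd_num j) at_top"
    proof -
      have "((\<lambda>y. y / (odd_num j - - y)) \<longlongrightarrow> 1) at_top" by real_asymp
      then have "((\<lambda>y. 1 / odd_num j * (y / (odd_num j - - y))) \<longlongrightarrow> 1 / odd_num j * 1) at_top" by (rule tendsto_mult_left)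
      then show ?thesis by simp
    qed
    ultimately have "((\<lambda>y. odd_prod (- y) j * (y / (odd_num j * (odd_num j - - y)))) \<longlongrightarrow> (\<Prod>l<j. -1) * (1 / odd_num j)) at_top"
      by (rule tendsto_mult)
    then show "((\<lambda>y. y * odd_term (- y) j) \<longlongrightarrow> (-1) ^ j / odd_num j) at_top"
      by (simp add: odd_term_def mult_ac)
  qed
  then have "eventually (\<lambda>y. dist (\<Sum>j<N. y * odd_term (- y) j) (\<Sum>j<N. (-1) ^ j / odd_num j) < e / 3) at_top"
    using e by (intro tendstoD) auto
  moreover have "eventually (\<lambda>y. y > odd_num N) at_top" by (rule eventually_gt_at_top)
  ultimately show "eventually (\<lambda>y. dist (y * odd_series (- y)) (pi / 4) < e) at_top"
  proof eventually_elim
    case (elim y)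
    have "y > 0" using elim by (smt (verit) of_nat_0_le_iff)
    then have "(\<lambda>M. \<Sum>j<M. y * odd_term (- y) j) \<longlonglongrightarrow> y * odd_series (- y)"
      unfolding odd_series_def sum_distrib_left[symmetric] by (intro tendsto_intros summable_LIMSEQ summable_odd_term) auto
    then have "(\<lambda>M. \<bar>(\<Sum>j<M. y * odd_term (- y) j) - (\<Sum>j<N. y * odd_term (- y) j)\<bar>)
        \<longlonglongrightarrow> \<bar>y * odd_series (- y) - (\<Sum>j<N. y * odd_term (- y) j)\<bar>"
      by (intro tendsto_intros)
    moreover have "\<forall>M\<ge>N. \<bar>(\<Sum>j<M. y * odd_term (- y) j) - (\<Sum>j<N. y * odd_term (- y) j)\<bar> \<le> err N"
    proof (intro allI impI)
      fix M assume "M \<ge> N"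
      then have "(\<Sum>j<M. y * odd_term (- y) j) - (\<Sum>j<N. y * odd_term (- y) j) = (\<Sum>j=N..<M. y * odd_term (- y) j)"
        using sum_diff_nat_ivl[of 0 N M "\<lambda>j. y * odd_term (- y) j"] by (simp add: atLeast0LessThan)
      then show "\<bar>(\<Sum>j<M. y * odd_term (- y) j) - (\<Sum>j<N. y * odd_term (- y) j)\<bar> \<le> err N"
        using odd_term_tail_le[OF elim(2) \<open>M \<ge> N\<close>] by (simp add: err_def)
    qed
    ultimately have "\<bar>y * odd_series (- y) - (\<Sum>j<N. y * odd_term (- y) j)\<bar> \<le> err N"
      by (meson LIMSEQ_le_const2)
    then show ?case using N elim(1) unfolding dist_real_def by linarith
  qed
qed

subsection \<open>Coefficients of the limit\<close>

text \<open>Partial sums of the Dirichlet eta series, grouped in pairs so that all terms are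
  nonnegative and the exponent 1 needs no separate treatment.\<close>

definition eta_part :: "nat \<Rightarrow> nat \<Rightarrow> real" where
  "eta_part p j = (\<Sum>i<p. 1 / odd_num i ^ j - 1 / (2 * real i + 2) ^ j)"

definition eta :: "nat \<Rightarrow> real" where
  "eta j = (\<Sum>i. 1 / odd_num i ^ j - 1 / (2 * real i + 2) ^ j)"

lemma eta_term_nonneg: "0 \<le> 1 / odd_num i ^ j - 1 / (2 * real i + 2) ^ j"
  by (simp, intro divide_left_mono power_mono) auto

text \<open>Each subtracted even term outweighs the next odd one, which leaves a telescoping sum.
  The bound is uniform in both arguments and later serves as a majorant.\<close>

lemma eta_part_le_1: "eta_part p j \<le> 1"
proof -
  have "eta_part p j \<le> 1 - 1 / odd_num p ^ j" 
  proof (induction p)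
    case (Suc p)
    have "1 / odd_num (Suc p) ^ j \<le> 1 / (2 * real p + 2) ^ j"
      by (intro divide_left_mono power_mono) auto
    then show ?case using Suc by (simp add: eta_part_def)
  qed (simp add: eta_part_def)
  also have "\<dots> \<le> 1" by simp
  finally show ?thesis .
qed

lemma summable_eta: "summable (\<lambda>i. 1 / odd_num i ^ j - 1 / (2 * real i + 2) ^ j)"
  using eta_part_le_1[of _ j] unfolding eta_part_def
  by (intro summableI_nonneg_bounded eta_term_nonneg)

lemma eta_part_tendsto: "(\<lambda>p. eta_part p j) \<longlonglongrightarrow> eta j"
  unfolding eta_part_def eta_def by (intro summable_LIMSEQ summable_eta)

lemma eta_part_nonneg: "0 \<le> eta_part p j"
  unfolding eta_part_def by (intro sum_nonneg eta_term_nonneg)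

lemma eta_bounds: "0 \<le> eta j" "eta j \<le> 1"
  using LIMSEQ_le_const[OF eta_part_tendsto] LIMSEQ_le_const2[OF eta_part_tendsto]
    eta_part_nonneg eta_part_le_1 by blast+

section \<open>Logarithm of the product produced by the shifts\<close>

lemma ln_1_minus_sums:
  fixes t :: real
  assumes "\<bar>t\<bar> < 1"
  shows "(\<lambda>n. t ^ Suc n / real (Suc n)) sums (- ln (1 - t))"
proof -
  have s: "summable (\<lambda>n. t ^ Suc n / real (Suc n))"
  proof (rule summable_comparison_test')
    show "summable (\<lambda>n. \<bar>t\<bar> ^ n)" using assms by (intro summable_geometric) auto
    fix n :: nat
    have "\<bar>t\<bar> ^ Suc n / real (Suc n) \<le> \<bar>t\<bar> ^ n / 1"
      using assms by (intro frac_le) (auto intro: mult_left_le_one_le)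
    then show "norm (t ^ Suc n / real (Suc n)) \<le> \<bar>t\<bar> ^ n"
      by (simp add: power_abs abs_mult)
  qed
  have "ln (1 - t) = (\<Sum>n. (-1) ^ n * (1 / real (n + 1)) * ((1 - t) - 1) ^ Suc n)"
    using assms by (intro ln_series) auto
  also have "\<dots> = (\<Sum>n. - (t ^ Suc n / real (Suc n)))"
  proof (intro suminf_cong)
    fix n
    have "((1 - t) - 1) ^ Suc n = (-1) ^ Suc n * t ^ Suc n"
      by (subst power_mult_distrib[symmetric]) simp
    then show "(-1) ^ n * (1 / real (n + 1)) * ((1 - t) - 1) ^ Suc n = - (t ^ Suc n / real (Suc n))"
      by (simp flip: power_mult_distrib)
  qed
  also have "\<dots> = - (\<Sum>n. t ^ Suc n / real (Suc n))"
    by (rule suminf_minus[OF s])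
  finally show ?thesis using s by (simp add: sums_iff)
qed

definition shift_prod :: "real \<Rightarrow> nat \<Rightarrow> real" where
  "shift_prod x p = (\<Prod>i<p. ((2 * real i + 2 - x) / (2 * real i + 1 - x)) ^ 2)"

lemma shift_prod_pos: "x < 1 \<Longrightarrow> shift_prod x p > 0"
  unfolding shift_prod_def by (intro prod_pos zero_less_power divide_pos_pos) auto

text \<open>\<open>shift_prod x p\<close> by itself diverges as \<open>p\<close> grows. Divided by
  its value at 0, its factors become \<open>((1 - x / b) / (1 - x / a)) ^ 2\<close> with a = 2i + 1
  and b = 2i + 2, and Mercator's series gives the coefficients
  \<open>2 (1 / a^n - 1 / b^n) / n\<close> of the logarithm.\<close>

lemma shift_prod_ratio:
  assumes "\<bar>x\<bar> < 1"
  shows "(\<lambda>n. 2 * eta_part p (Suc n) * x ^ Suc n / real (Suc n)) sums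
           ln (shift_prod x p / shift_prod 0 p)"
proof (induction p)
  case 0
  then show ?case by (simp add: eta_part_def shift_prod_def)
next
  case (Suc p)
  let ?a = "2 * real p + 1" and ?b = "2 * real p + 2"
  have ab: "\<bar>x / ?a\<bar> < 1" "\<bar>x / ?b\<bar> < 1" using assms by (auto simp: field_simps abs_if split: if_splits)
  then have pos: "0 < 1 - x / ?a" "0 < 1 - x / ?b" by linarith+
  from ab have "(\<lambda>n. (x / ?a) ^ Suc n / real (Suc n) - (x / ?b) ^ Suc n / real (Suc n)) sums
      (- ln (1 - x / ?a) - - ln (1 - x / ?b))"
    by (intro sums_diff ln_1_minus_sums)
  moreover have "(x / ?a) ^ Suc n / real (Suc n) - (x / ?b) ^ Suc n / real (Suc n)
      = (1 / ?a ^ Suc n - 1 / ?b ^ Suc n) * x ^ Suc n / real (Suc n)" for n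
    unfolding power_divide by (simp only: left_diff_distrib diff_divide_distrib) simp
  ultimately have "(\<lambda>n. 2 * ((1 / ?a ^ Suc n - 1 / ?b ^ Suc n) * x ^ Suc n / real (Suc n))) sums
      (2 * (ln (1 - x / ?b) - ln (1 - x / ?a)))"
    by (intro sums_mult) simp
  from sums_add[OF Suc this] have "(\<lambda>n. 2 * eta_part p (Suc n) * x ^ Suc n / real (Suc n)
      + 2 * ((1 / ?a ^ Suc n - 1 / ?b ^ Suc n) * x ^ Suc n / real (Suc n))) sums
      (ln (shift_prod x p / shift_prod 0 p) + 2 * (ln (1 - x / ?b) - ln (1 - x / ?a)))" .
  moreover have eq: "2 * e * X / N + 2 * (d * X / N) = 2 * (e + d) * X / N" for e d X N :: real
    by (simp add: algebra_simps add_divide_distrib)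
  ultimately have "(\<lambda>n. 2 * eta_part (Suc p) (Suc n) * x ^ Suc n / real (Suc n)) sums
      (ln (shift_prod x p / shift_prod 0 p) + 2 * (ln (1 - x / ?b) - ln (1 - x / ?a)))"
    unfolding eq by (simp only: eta_part_def sum.lessThan_Suc)
  also have "2 * (ln (1 - x / ?b) - ln (1 - x / ?a)) = ln (((1 - x / ?b) / (1 - x / ?a)) ^ 2)"
    using pos by (simp add: ln_realpow ln_div)
  also have "ln (shift_prod x p / shift_prod 0 p) + \<dots> =
      ln (shift_prod x p / shift_prod 0 p * ((1 - x / ?b) / (1 - x / ?a)) ^ 2)"
    using assms shift_prod_pos[of x p] shift_prod_pos[of 0 p] pos
    by (intro ln_mult_pos[symmetric] zero_less_power divide_pos_pos) auto
  also have "shift_prod x p / shift_prod 0 p * ((1 - x / ?b) / (1 - x / ?a)) ^ 2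
      = shift_prod x (Suc p) / shift_prod 0 (Suc p)"
  proof -
    have "(1 - x / ?b) / (1 - x / ?a) = ((?b - x) / (?a - x)) / (?b / ?a)"
      using assms by (simp add: divide_simps)
    then show ?thesis by (simp add: shift_prod_def power_divide power_mult_distrib mult_ac)
  qed
  finally show ?case .
qed

text \<open>Division by 0 gives 0, so the constant coefficient is 0.\<close>

definition eta_series :: "real fps" where
  "eta_series = Abs_fps (\<lambda>n. 2 * eta n / real n)"

lemma eval_eta_series: "eval_fps eta_series x = (\<Sum>n. 2 * eta (Suc n) * x ^ Suc n / real (Suc n))"
  if "summable (\<lambda>n. eta_series $ n * x ^ n)"
  unfolding eval_fps_def suminf_split_head[OF that, symmetric] using suminf_split_head[OF that]
  by (simp add: eta_series_def)

lemma summable_eta_series: 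
  assumes "\<bar>x\<bar> < 1"
  shows "summable (\<lambda>n. eta_series $ n * x ^ n)"
proof (rule summable_comparison_test')
  show "summable (\<lambda>n. 2 * \<bar>x\<bar> ^ n)" using assms by (intro summable_mult summable_geometric) auto
  show "norm (eta_series $ n * x ^ n) \<le> 2 * \<bar>x\<bar> ^ n" if "n \<ge> 0" for n
  proof (cases n)
    case (Suc k)
    have "2 * eta n / real n \<le> 2 / 1" using eta_bounds[of n] Suc by (intro frac_le) auto
    from mult_right_mono[OF this, of "\<bar>x\<bar> ^ n"] show ?thesis using eta_bounds[of n]
      by (simp add: eta_series_def abs_mult power_abs)
  qed (simp add: eta_series_def)
qed

lemma fps_conv_radius_ge_1:
  fixes F :: "real fps"
  assumes "\<And>x. 0 < x \<Longrightarrow> x < 1 \<Longrightarrow> summable (\<lambda>n. F $ n * x ^ n)"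
  shows "fps_conv_radius F \<ge> 1"
  unfolding fps_conv_radius_def
proof (rule conv_radius_geI_ex)
  fix r :: real assume "0 < r" "ereal r < 1"
  then show "\<exists>z. norm z = r \<and> summable (\<lambda>n. F $ n * z ^ n)"
    using assms[of r] by (intro exI[of _ r]) auto
qed

lemma eta_series_radius: "fps_conv_radius eta_series \<ge> 1"
  by (intro fps_conv_radius_ge_1 summable_eta_series) auto

text \<open>Tannery's theorem, applied to the logarithms with majorant
  \<open>2 * \<bar>x\<bar> ^ Suc n\<close>, which comes from \<open>eta_part_le_1\<close>.\<close>

lemma shift_prod_tendsto:
  assumes "\<bar>x\<bar> < 1"
  shows "(\<lambda>p. shift_prod x p / shift_prod 0 p) \<longlonglongrightarrow> exp (eval_fps eta_series x)"
proof -
  have "(\<lambda>p. \<Sum>n. 2 * eta_part p (Suc n) * x ^ Suc n / real (Suc n)) \<longlonglongrightarrow> 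
          (\<Sum>n. 2 * eta (Suc n) * x ^ Suc n / real (Suc n))"
  proof (rule tannerys_theorem[THEN conjunct2, THEN conjunct2])
    show "(\<lambda>p. 2 * eta_part p (Suc k) * x ^ Suc k / real (Suc k)) 
        \<longlonglongrightarrow> 2 * eta (Suc k) * x ^ Suc k / real (Suc k)" for k
      by (intro tendsto_intros eta_part_tendsto) auto
    show "summable (\<lambda>n. 2 * \<bar>x\<bar> ^ Suc n)"
      using assms by (intro summable_mult summable_Suc_iff[THEN iffD2] summable_geometric) auto
    have "norm (2 * eta_part p (Suc k) * x ^ Suc k / real (Suc k)) \<le> 2 * \<bar>x\<bar> ^ Suc k" for p k
    proof -
      have "(2 * eta_part p (Suc k) * \<bar>x\<bar> ^ Suc k) / real (Suc k) \<le> (2 * 1 * \<bar>x\<bar> ^ Suc k) / 1"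
        using eta_part_le_1 eta_part_nonneg by (intro frac_le mult_right_mono mult_left_mono) auto
      then show ?thesis using eta_part_nonneg[of p "Suc k"] by (simp add: abs_mult power_abs)
    qed
    then show "eventually (\<lambda>(k, p). norm (2 * eta_part p (Suc k) * x ^ Suc k / real (Suc k))
        \<le> 2 * \<bar>x\<bar> ^ Suc k) (at_top \<times>\<^sub>F sequentially)"
      by (intro always_eventually) auto
  qed auto
  then have "(\<lambda>p. ln (shift_prod x p / shift_prod 0 p)) \<longlonglongrightarrow> eval_fps eta_series x"
    using shift_prod_ratio[OF assms] eval_eta_series[OF summable_eta_series[OF assms]]
    by (simp add: sums_iff)
  then have "(\<lambda>p. exp (ln (shift_prod x p / shift_prod 0 p))) \<longlonglongrightarrow> exp (eval_fps eta_series x)"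
    by (intro tendsto_intros)
  moreover have "exp (ln (shift_prod x p / shift_prod 0 p)) = shift_prod x p / shift_prod 0 p" for p
    using assms shift_prod_pos[of x p] shift_prod_pos[of 0 p] by (intro exp_ln divide_pos_pos) auto
  ultimately show ?thesis by simp
qed

text \<open>Both x and 0 are moved \<open>p\<close> double steps to the left. There the two values
  of \<open>odd_series\<close> have the same asymptotics, so their nonzero common limit
  \<open>pi / 4\<close> cancels and only the ratio of the shift products survives.\<close>

lemma odd_series_eq_exp:
  assumes "-1 < x" "x \<le> 0"
  shows "odd_series x = odd_series 0 * exp (eval_fps eta_series x)"
proof -
  have lim: "(\<lambda>p. (2 * real p - x) * odd_series (x - 2 * real p)) \<longlonglongrightarrow> pi / 4" if "x \<le> 0" for x
  proof -
    have "filterlim (\<lambda>p. 2 * real p - x) at_top sequentially" by real_asymp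
    from filterlim_compose[OF odd_series_asymptotic this] show ?thesis by simp
  qed
  have "(\<lambda>p. (2 * real p - x) / (2 * real p)) \<longlonglongrightarrow> 1" by real_asymp
  then have 1: "(\<lambda>p. odd_series x * (2 * real p * odd_series (- (2 * real p))) * ((2 * real p - x) / (2 * real p)))
      \<longlonglongrightarrow> odd_series x * (pi / 4) * 1"
    using lim[of 0] by (intro tendsto_intros) auto
  have 2: "(\<lambda>p. odd_series 0 * (shift_prod x p / shift_prod 0 p) * ((2 * real p - x) * odd_series (x - 2 * real p)))
      \<longlonglongrightarrow> odd_series 0 * exp (eval_fps eta_series x) * (pi / 4)"
    using assms by (intro tendsto_intros lim shift_prod_tendsto) auto
  \<comment> \<open>The two shift relations are multiplied crosswise, which avoids dividing by
    \<open>odd_series (- (2 * real p))\<close>; the extra quotient, tending to 1, reconciles the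
    normalisations \<open>2 * real p\<close> and \<open>2 * real p - x\<close>.\<close>
  have "eventually (\<lambda>p. odd_series x * (2 * real p * odd_series (- (2 * real p))) * ((2 * real p - x) / (2 * real p))
      = odd_series 0 * (shift_prod x p / shift_prod 0 p) * ((2 * real p - x) * odd_series (x - 2 * real p))) sequentially"
    using eventually_gt_at_top[of 0]
  proof eventually_elim
    case (elim p)
    have "odd_series x = shift_prod x p * odd_series (x - 2 * real p)" "odd_series 0 = shift_prod 0 p * odd_series (- (2 * real p))"
      using odd_series_iterate[of x p] odd_series_iterate[of 0 p] assms by (simp_all add: shift_prod_def)
    then show ?case using elim shift_prod_pos[of 0 p] by simp
  qed
  from LIMSEQ_unique[OF Lim_transform_eventually[OF 1 this] 2]
  have "odd_series x * (pi / 4) * 1 = odd_series 0 * exp (eval_fps eta_series x) * (pi / 4)" .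
  then show ?thesis by simp
qed

section \<open>Values of the truncated power series on the unit interval\<close>

lemma eval_geo:
  assumes "0 \<le> c" "c \<le> 1" "\<bar>x\<bar> < 1"
  shows "summable (\<lambda>n. geo c $ n * x ^ n)" "eval_fps (geo c) x = 1 / (1 - c * x)"
proof -
  have "\<bar>c * x\<bar> \<le> \<bar>x\<bar>" using assms by (simp add: abs_mult mult_left_le_one_le)
  then have "\<bar>c * x\<bar> < 1" using assms by linarith
  then have "(\<lambda>n. (c * x) ^ n) sums (1 / (1 - c * x))"
    by (intro geometric_sums) simp
  then show "summable (\<lambda>n. geo c $ n * x ^ n)" "eval_fps (geo c) x = 1 / (1 - c * x)"
    by (simp_all add: geo_def eval_fps_def sums_iff power_mult_distrib)
qed

lemma geo_radius: "0 \<le> c \<Longrightarrow> c \<le> 1 \<Longrightarrow> fps_conv_radius (geo c) \<ge> 1"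
  by (intro fps_conv_radius_ge_1 eval_geo) auto

lemma radius_mult_ge_1:
  fixes F H :: "real fps"
  shows "fps_conv_radius F \<ge> 1 \<Longrightarrow> fps_conv_radius H \<ge> 1 \<Longrightarrow> fps_conv_radius (F * H) \<ge> 1"
  using fps_conv_radius_mult[of F H] by (meson min.boundedI order_trans)

lemma radius_add_ge_1:
  fixes F H :: "real fps"
  shows "fps_conv_radius F \<ge> 1 \<Longrightarrow> fps_conv_radius H \<ge> 1 \<Longrightarrow> fps_conv_radius (F + H) \<ge> 1"
  using fps_conv_radius_add[of F H] by (meson min.boundedI order_trans)

lemma norm_less_radius: "fps_conv_radius F \<ge> 1 \<Longrightarrow> \<bar>x\<bar> < 1 \<Longrightarrow> ereal (norm x) < fps_conv_radius F"
  for F :: "real fps" and x :: real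
  by (rule order.strict_trans2[of _ 1]) (auto simp: one_ereal_def)

lemma eval_fps_mult_unit:
  fixes F H :: "real fps"
  assumes "fps_conv_radius F \<ge> 1" "fps_conv_radius H \<ge> 1" "\<bar>x\<bar> < 1"
  shows "eval_fps (F * H) x = eval_fps F x * eval_fps H x"
  using assms by (intro eval_fps_mult norm_less_radius)

lemma eval_fps_add_unit:
  fixes F H :: "real fps"
  assumes "fps_conv_radius F \<ge> 1" "fps_conv_radius H \<ge> 1" "\<bar>x\<bar> < 1"
  shows "eval_fps (F + H) x = eval_fps F x + eval_fps H x"
  using assms by (intro eval_fps_add norm_less_radius)

lemma eval_pfps:
  "fps_conv_radius (pfps odd_num M) \<ge> 1" (is ?A)
  "\<bar>x\<bar> < 1 \<Longrightarrow> eval_fps (pfps odd_num M) x = odd_prod x M" (is "_ \<Longrightarrow> ?B")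
proof -
  have "?A \<and> (\<bar>x\<bar> < 1 \<longrightarrow> ?B)"
  proof (induction M)
    case (Suc M)
    define L where "L = 1 + fps_const (1 / odd_num M) * fps_X"
    define Ge where "Ge = geo (1 / odd_num M)"
    have S: "pfps odd_num (Suc M) = pfps odd_num M * (L * Ge)"
      by (simp add: pfps_def L_def Ge_def)
    have L1: "fps_conv_radius L \<ge> 1"
      unfolding L_def by (intro radius_add_ge_1 radius_mult_ge_1) auto
    have G1: "fps_conv_radius Ge \<ge> 1" unfolding Ge_def by (intro geo_radius) auto
    have B: "eval_fps (pfps odd_num (Suc M)) x = odd_prod x (Suc M)" if x: "\<bar>x\<bar> < 1"
    proof -
      have "eval_fps (pfps odd_num (Suc M)) x = odd_prod x M * (eval_fps L x * eval_fps Ge x)"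
        unfolding S using Suc L1 G1 x radius_mult_ge_1[OF L1 G1]
        by (simp add: eval_fps_mult_unit)
      also have "eval_fps L x = 1 + x / odd_num M"
        unfolding L_def using x by (simp add: eval_fps_add_unit eval_fps_mult_unit radius_mult_ge_1)
      also have "eval_fps Ge x = 1 / (1 - 1 / odd_num M * x)"
        unfolding Ge_def using x by (intro eval_geo) auto
      also have "(1 + x / odd_num M) * (1 / (1 - 1 / odd_num M * x)) = (odd_num M + x) / (odd_num M - x)"
        using x by (simp add: divide_simps)
      finally show ?thesis by (simp add: odd_prod_Suc)
    qed
    show ?case using B Suc L1 G1 unfolding S by (auto intro!: radius_mult_ge_1)
  qed (simp add: pfps_def)
  then show ?A "\<bar>x\<bar> < 1 \<Longrightarrow> ?B" by auto
qed

lemma eval_gfps: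
  "fps_conv_radius (gfps odd_num M) \<ge> 1" (is ?A)
  "\<bar>x\<bar> < 1 \<Longrightarrow> eval_fps (gfps odd_num M) x = (\<Sum>j<M. odd_term x j)" (is "_ \<Longrightarrow> ?B")
proof -
  have "?A \<and> (\<bar>x\<bar> < 1 \<longrightarrow> ?B)"
  proof (induction M)
    case (Suc M)
    define Ge where "Ge = geo (1 / odd_num M)"
    define P where "P = pfps odd_num M"
    define K where "K = fps_const (1 / odd_num M ^ 2)"
    have S: "gfps odd_num (Suc M) = gfps odd_num M + K * Ge * P"
      by (simp add: gfps_def K_def Ge_def P_def)
    have 1: "fps_conv_radius Ge \<ge> 1" "fps_conv_radius P \<ge> 1" "fps_conv_radius K \<ge> 1"
      unfolding Ge_def P_def K_def by (auto intro!: geo_radius eval_pfps(1))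
    have B: "eval_fps (gfps odd_num (Suc M)) x = (\<Sum>j<Suc M. odd_term x j)" if x: "\<bar>x\<bar> < 1"
    proof -
      have "eval_fps (gfps odd_num (Suc M)) x = (\<Sum>j<M. odd_term x j) + eval_fps K x * eval_fps Ge x * eval_fps P x"
        unfolding S using Suc 1 x
        by (simp add: eval_fps_add_unit eval_fps_mult_unit radius_mult_ge_1)
      also have "eval_fps K x * eval_fps Ge x * eval_fps P x = 1 / odd_num M ^ 2 * (1 / (1 - 1 / odd_num M * x)) * odd_prod x M"
        unfolding Ge_def K_def P_def using x by (simp add: eval_geo(2) eval_pfps(2))
      also have "\<dots> = odd_term x M"
        using x by (simp add: odd_term_def divide_simps power2_eq_square)
      finally show ?thesis by simp
    qed
    show ?case using B Suc 1 unfolding S by (auto intro!: radius_mult_ge_1 radius_add_ge_1)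
  qed (simp add: gfps_def)
  then show ?A "\<bar>x\<bar> < 1 \<Longrightarrow> ?B" by auto
qed

section \<open>Coefficientwise limit of the truncated series\<close>

lemma fps_mult_nonneg: 
  fixes F H :: "real fps"
  assumes "\<And>n. F $ n \<ge> 0" "\<And>n. H $ n \<ge> 0" 
  shows "(F * H) $ n \<ge> 0"
  unfolding fps_mult_nth using assms by (intro sum_nonneg mult_nonneg_nonneg) auto

lemma pfps_nonneg: "pfps odd_num M $ n \<ge> 0"
proof (induction M arbitrary: n)
  case (Suc M)
  have "pfps odd_num (Suc M) = pfps odd_num M * ((1 + fps_const (1 / odd_num M) * fps_X) * geo (1 / odd_num M))"
    by (simp add: pfps_def)
  moreover have "(1 + fps_const (1 / odd_num M) * fps_X) $ n \<ge> 0" for n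
    by (simp add: fps_X_def)
  moreover have "geo (1 / odd_num M) $ n \<ge> 0" for n by (simp add: geo_def)
  ultimately show ?case using Suc by (metis fps_mult_nonneg)
qed (simp add: pfps_def)

lemma gfps_step_nonneg: "(fps_const (1 / odd_num j ^ 2) * geo (1 / odd_num j) * pfps odd_num j) $ n \<ge> 0"
  by (intro fps_mult_nonneg pfps_nonneg) (auto simp: geo_def)

lemma gfps_nonneg: "gfps odd_num M $ n \<ge> 0"
  unfolding gfps_def fps_sum_nth by (intro sum_nonneg gfps_step_nonneg)

lemma gfps_mono: "M \<le> M' \<Longrightarrow> gfps odd_num M $ n \<le> gfps odd_num M' $ n"
  unfolding gfps_def fps_sum_nth by (intro sum_mono2 gfps_step_nonneg) auto

definition gfps_lim :: "real fps" where
  "gfps_lim = Abs_fps (\<lambda>n. lim (\<lambda>M. gfps odd_num M $ n))"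

lemma summable_gfps: "\<bar>x\<bar> < 1 \<Longrightarrow> summable (\<lambda>n. gfps odd_num M $ n * x ^ n)"
  by (intro summable_fps norm_less_radius eval_gfps)

text \<open>With nonnegative coefficients and x, a partial sum is at most the full value, which is a
  partial sum of \<open>odd_term x\<close>. The bound at positive x controls each single coefficient
  and also the radius of convergence of the limit.\<close>

lemma gfps_partial_le:
  assumes "0 < x" "x < 1"
  obtains B where "\<And>M N. (\<Sum>n<N. gfps odd_num M $ n * x ^ n) \<le> B"
proof -
  obtain B where B: "\<And>M. (\<Sum>j<M. odd_term x j) \<le> B" using sum_odd_term_bounded assms by blast
  have "(\<Sum>n<N. gfps odd_num M $ n * x ^ n) \<le> B" for M N
  proof -
    have "(\<Sum>n<N. gfps odd_num M $ n * x ^ n) \<le> eval_fps (gfps odd_num M) x"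
      unfolding eval_fps_def using assms
      by (intro sum_le_suminf summable_gfps mult_nonneg_nonneg gfps_nonneg) auto
    then show ?thesis using B[of M] eval_gfps(2)[of x M] assms by simp
  qed
  then show ?thesis using that by blast
qed

lemma gfps_tendsto: "(\<lambda>M. gfps odd_num M $ n) \<longlonglongrightarrow> gfps_lim $ n"
proof -
  \<comment> \<open>Any point of (0, 1) would do; at \<open>1/2\<close> each coefficient of index
    \<open>n\<close> is at most \<open>B * 2 ^ n\<close>.\<close>
  obtain B where B: "\<And>M N. (\<Sum>n<N. gfps odd_num M $ n * (1/2) ^ n) \<le> B"
    using gfps_partial_le[of "1/2"] by auto
  have "gfps odd_num M $ n \<le> B * 2 ^ n" for M
  proof -
    have "gfps odd_num M $ n * (1/2) ^ n \<le> (\<Sum>k<Suc n. gfps odd_num M $ k * (1/2) ^ k)"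
      by (intro member_le_sum mult_nonneg_nonneg gfps_nonneg) auto
    also have "\<dots> \<le> B" by (rule B)
    finally show ?thesis by (simp add: power_divide field_simps)
  qed
  then have "Bseq (\<lambda>M. gfps odd_num M $ n)"
    using gfps_nonneg by (intro BseqI'[of _ "B * 2 ^ n"]) auto
  then have "convergent (\<lambda>M. gfps odd_num M $ n)"
    by (intro Bseq_mono_convergent) (auto intro: gfps_mono)
  then show ?thesis by (simp add: gfps_lim_def convergent_LIMSEQ_iff)
qed

lemma gfps_le_gfps_lim: "gfps odd_num M $ n \<le> gfps_lim $ n"
  by (rule LIMSEQ_le_const[OF gfps_tendsto]) (auto intro!: exI[of _ M] gfps_mono)

lemma gfps_lim_nonneg: "gfps_lim $ n \<ge> 0"
  using gfps_le_gfps_lim[of 0 n] gfps_nonneg[of 0 n] by linarith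

lemma summable_gfps_lim: "\<bar>x\<bar> < 1 \<Longrightarrow> summable (\<lambda>n. gfps_lim $ n * \<bar>x\<bar> ^ n)"
proof (cases "x = 0")
  case False
  assume "\<bar>x\<bar> < 1"
  then obtain B where B: "\<And>M N. (\<Sum>n<N. gfps odd_num M $ n * \<bar>x\<bar> ^ n) \<le> B"
    using gfps_partial_le[of "\<bar>x\<bar>"] False by auto
  have "(\<Sum>n<N. gfps_lim $ n * \<bar>x\<bar> ^ n) \<le> B" for N
    by (rule LIMSEQ_le_const2[of "\<lambda>M. \<Sum>n<N. gfps odd_num M $ n * \<bar>x\<bar> ^ n"])
       (auto intro!: tendsto_intros gfps_tendsto B)
  then show ?thesis by (intro summableI_nonneg_bounded mult_nonneg_nonneg gfps_lim_nonneg) auto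
qed (simp add: summable_zero_power')

lemma gfps_lim_radius: "fps_conv_radius gfps_lim \<ge> 1"
proof (rule fps_conv_radius_ge_1)
  fix x :: real assume "0 < x" "x < 1"
  then show "summable (\<lambda>n. gfps_lim $ n * x ^ n)" using summable_gfps_lim[of x] by simp
qed

text \<open>The coefficients increase to those of \<open>gfps_lim\<close>, so
  \<open>gfps_lim\<close> evaluated at \<open>\<bar>x\<bar>\<close> is a summable majorant for
  exchanging the two limits.\<close>

lemma eval_gfps_lim:
  assumes "-1 < x" "x \<le> 0"
  shows "eval_fps gfps_lim x = odd_series x"
proof -
  have "(\<lambda>M. eval_fps (gfps odd_num M) x) \<longlonglongrightarrow> eval_fps gfps_lim x"
    unfolding eval_fps_def
  proof (rule tannerys_theorem[THEN conjunct2, THEN conjunct2])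
    show "(\<lambda>M. gfps odd_num M $ k * x ^ k) \<longlonglongrightarrow> gfps_lim $ k * x ^ k" for k
      by (intro tendsto_intros gfps_tendsto)
    show "summable (\<lambda>n. gfps_lim $ n * \<bar>x\<bar> ^ n)" using assms by (intro summable_gfps_lim) auto
    show "eventually (\<lambda>(k, M). norm (gfps odd_num M $ k * x ^ k) \<le> gfps_lim $ k * \<bar>x\<bar> ^ k) (at_top \<times>\<^sub>F sequentially)"
      by (intro always_eventually)
         (auto simp: abs_mult power_abs abs_of_nonneg[OF gfps_nonneg] intro!: mult_right_mono gfps_le_gfps_lim)
  qed auto
  moreover have "(\<lambda>M. eval_fps (gfps odd_num M) x) \<longlonglongrightarrow> odd_series x"
    using assms by (simp add: eval_gfps(2) odd_series_def summable_LIMSEQ summable_odd_term)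
  ultimately show ?thesis using LIMSEQ_unique by blast
qed

section \<open>From functions on a left neighbourhood of 0 to formal power series\<close>

lemma eval_fps_eq_0_left:
  fixes F :: "real fps"
  assumes "fps_conv_radius F \<ge> 1" "\<And>x. -1 < x \<Longrightarrow> x < 0 \<Longrightarrow> eval_fps F x = 0"
  shows "F = 0"
proof (rule ccontr)
  assume "F \<noteq> 0"
  define H where "H = fps_shift (subdegree F) F"
  have FH: "F = H * fps_X ^ subdegree F" unfolding H_def by (rule subdegree_decompose)
  have H1: "fps_conv_radius H \<ge> 1" using assms(1) by (simp add: H_def)
  have "eval_fps H x = 0" if "-1 < x" "x < 0" for x
  proof -
    have "0 = eval_fps (H * fps_X ^ subdegree F) x" using assms(2) that FH by simp
    also have "\<dots> = eval_fps H x * x ^ subdegree F"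
      using that H1 by (subst eval_fps_mult_unit) auto
    finally show ?thesis using that by simp
  qed
  \<comment> \<open>Once the power of X is split off, \<open>H\<close> vanishes to the left of 0 and
    is continuous there. Hence its constant term, the leading coefficient of \<open>F\<close>, would
    be 0.\<close>
  then have "eventually (\<lambda>x. eval_fps H x = 0) (at_left 0)"
    by (intro eventually_at_leftI[of "-1"]) auto
  moreover have "isCont (eval_fps H) 0"
    using norm_less_radius[OF H1, of 0] by (intro continuous_eval_fps) auto
  then have "(eval_fps H \<longlongrightarrow> eval_fps H 0) (at_left 0)"
    by (simp add: isCont_def filterlim_at_split)
  ultimately have "((\<lambda>_. 0) \<longlongrightarrow> eval_fps H 0) (at_left (0::real))"
    by (subst (asm) tendsto_cong[of _ "\<lambda>_. 0"]) auto
  then have "eval_fps H 0 = 0" by (simp add: tendsto_const_iff)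
  then have "H $ 0 = 0" by (simp add: eval_fps_at_0)
  then show False using \<open>F \<noteq> 0\<close> by (simp add: H_def)
qed

text \<open>The closed form is known only as a function on (-1, 0]. Its logarithmic derivative is a
  relation between power series, which transfers to coefficients without evaluating a formal
  composition with the exponential.\<close>

lemma gfps_lim_ode: "fps_deriv gfps_lim = fps_deriv eta_series * gfps_lim" and gfps_lim_0: "gfps_lim $ 0 = odd_series 0"
proof -
  have "eval_fps gfps_lim 0 = odd_series 0" using eval_gfps_lim[of 0] by simp
  then show "gfps_lim $ 0 = odd_series 0" by (simp add: eval_fps_at_0)
  let ?F = "fps_deriv gfps_lim - fps_deriv eta_series * gfps_lim"
  have r: "fps_conv_radius (fps_deriv gfps_lim) \<ge> 1" "fps_conv_radius (fps_deriv eta_series) \<ge> 1"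
    using gfps_lim_radius eta_series_radius by (auto intro: order_trans[OF _ fps_conv_radius_deriv])
  have "?F = 0"
  proof (rule eval_fps_eq_0_left)
    show "fps_conv_radius ?F \<ge> 1"
      using r(1) radius_mult_ge_1[OF r(2) gfps_lim_radius]
      by (intro order_trans[OF _ fps_conv_radius_diff]) auto
    fix x :: real assume x: "-1 < x" "x < 0"
    have "(eval_fps eta_series has_field_derivative eval_fps (fps_deriv eta_series) x) (at x)"
      using x eta_series_radius by (intro has_field_derivative_eval_fps norm_less_radius) auto
    then have "((\<lambda>x. odd_series 0 * exp (eval_fps eta_series x)) has_field_derivative
        (odd_series 0 * (exp (eval_fps eta_series x) * eval_fps (fps_deriv eta_series) x))) (at x)"
      by (auto intro!: derivative_eq_intros)
    also have "?this \<longleftrightarrow> (eval_fps gfps_lim has_field_derivative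
        (odd_series 0 * (exp (eval_fps eta_series x) * eval_fps (fps_deriv eta_series) x))) (at x)"
    proof (rule DERIV_cong_ev)
      have "eventually (\<lambda>t. t \<in> {-1<..<0}) (nhds x)"
        using x by (intro eventually_nhds_in_open) auto
      then show "eventually (\<lambda>t. odd_series 0 * exp (eval_fps eta_series t) = eval_fps gfps_lim t) (nhds x)"
      proof eventually_elim
        case (elim t)
        then show ?case using eval_gfps_lim[of t] odd_series_eq_exp[of t] by simp
      qed
    qed auto
    finally have D: "(eval_fps gfps_lim has_field_derivative
        (odd_series 0 * (exp (eval_fps eta_series x) * eval_fps (fps_deriv eta_series) x))) (at x)" .
    have "(eval_fps gfps_lim has_field_derivative eval_fps (fps_deriv gfps_lim) x) (at x)"
      using x gfps_lim_radius by (intro has_field_derivative_eval_fps norm_less_radius) auto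
    from DERIV_unique[OF this D]
    have "eval_fps (fps_deriv gfps_lim) x = odd_series 0 * (exp (eval_fps eta_series x) * eval_fps (fps_deriv eta_series) x)" .
    also have "\<dots> = eval_fps (fps_deriv eta_series) x * eval_fps gfps_lim x"
      using x eval_gfps_lim[of x] odd_series_eq_exp[of x] by simp
    finally show "eval_fps ?F x = 0"
      using x r gfps_lim_radius norm_less_radius[of "fps_deriv gfps_lim" x]
        norm_less_radius[OF radius_mult_ge_1[OF r(2) gfps_lim_radius], of x]
      by (simp add: eval_fps_diff eval_fps_mult_unit)
  qed
  then show "fps_deriv gfps_lim = fps_deriv eta_series * gfps_lim" by simp
qed

text \<open>The equation determines each coefficient from the preceding ones.\<close>

lemma fps_ode_unique:
  fixes F H L :: "real fps"
  assumes "fps_deriv F = L * F" "fps_deriv H = L * H" "F $ 0 = H $ 0"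
  shows "F = H"
proof (rule fps_ext)
  fix n show "F $ n = H $ n"
  proof (induction n rule: less_induct)
    case (less n)
    show ?case
    proof (cases n)
      case (Suc k)
      have "(L * F) $ k = (L * H) $ k"
        unfolding fps_mult_nth
      proof (intro sum.cong refl)
        fix i assume "i \<in> {0..k}"
        then have "F $ (k - i) = H $ (k - i)" using Suc by (intro less) auto
        then show "L $ i * F $ (k - i) = L $ i * H $ (k - i)" by simp
      qed
      then have "fps_deriv F $ k = fps_deriv H $ k" unfolding assms(1,2) .
      then have "real (Suc k) * F $ Suc k = real (Suc k) * H $ Suc k"
        by (simp only: fps_deriv_nth Suc_eq_plus1)
      then show ?thesis unfolding Suc by (simp del: of_nat_Suc)
    qed (use assms in simp)
  qed
qed

subsection \<open>Convergence to multiple t-values\<close>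

definition node :: "nat \<Rightarrow> nat \<Rightarrow> nat" where
  "node a j = a * (2 * j + 1)"

text \<open>The residue class of a modulo 2a consists of the odd multiples of a, so the level only
  rescales the odd numbers.\<close>

lemma cong_node_iff: "a > 0 \<Longrightarrow> m > 0 \<and> [m = a] (mod (2 * a)) \<longleftrightarrow> m \<in> range (node a)"
proof
  assume "a > 0" and m: "m > 0 \<and> [m = a] (mod (2 * a))"
  then have "m mod (2 * a) = a" by (simp add: cong_def)
  then have "m = node a (m div (2 * a))"
    using mult_div_mod_eq[of "2 * a" m] by (simp add: node_def algebra_simps)
  then show "m \<in> range (node a)" by blast
next
  assume "a > 0" "m \<in> range (node a)"
  then obtain j where "m = a * (2 * j + 1)" by (auto simp: node_def)
  then have "m = a + 2 * a * j" by (simp add: algebra_simps)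
  with \<open>a > 0\<close> show "m > 0 \<and> [m = a] (mod (2 * a))" by (simp add: cong_def)
qed

text \<open>Lists of positions, not of values; bounding the positions by \<open>M\<close> exhausts
  the summation domain by finite sets.\<close>

definition dec_lists :: "nat \<Rightarrow> nat \<Rightarrow> nat list set" where
  "dec_lists M n = {js. length js = n \<and> sorted_wrt (>) js \<and> set js \<subseteq> {..<M}}"

lemma dec_lists_0: "dec_lists M 0 = {[]}"
  by (auto simp: dec_lists_def)

lemma dec_lists_Suc: "dec_lists M (Suc n) = (\<Union>j\<in>{..<M}. (#) j ` dec_lists j n)"
proof (intro equalityI subsetI)
  fix js assume "js \<in> dec_lists M (Suc n)"
  then show "js \<in> (\<Union>j\<in>{..<M}. (#) j ` dec_lists j n)"
    by (cases js) (auto simp: dec_lists_def image_iff)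
qed (fastforce simp: dec_lists_def)

lemma finite_dec_lists [simp]: "finite (dec_lists M n)"
  by (induction n arbitrary: M) (auto simp: dec_lists_0 dec_lists_Suc)

lemma sum_dec_lists:
  "(\<Sum>js\<in>dec_lists M (dep ks). 1 / (\<Prod>i<dep ks. u (js ! i) ^ (ks ! i))) = trunc u ks M"
proof (induction ks arbitrary: M)
  case (Cons k ks)
  have "(\<Sum>js\<in>dec_lists M (dep (k # ks)). 1 / (\<Prod>i<dep (k # ks). u (js ! i) ^ ((k # ks) ! i)))
      = (\<Sum>j<M. \<Sum>js\<in>dec_lists j (dep ks).
           1 / (\<Prod>i<dep (k # ks). u ((j # js) ! i) ^ ((k # ks) ! i)))"
    unfolding list.size add_Suc_right add_0_right dec_lists_Suc by (rule sum_UN_Cons) auto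
  also have "\<dots> = (\<Sum>j<M. \<Sum>js\<in>dec_lists j (dep ks).
        1 / (\<Prod>i<dep ks. u (js ! i) ^ (ks ! i)) / u j ^ k)"
    by (simp add: prod.lessThan_Suc_shift mult.commute del: prod.lessThan_Suc)
  also have "\<dots> = trunc u (k # ks) M"
    by (simp add: sum_divide_distrib flip: Cons.IH)
  finally show ?case .
qed (simp add: dec_lists_0)

lemma mtv_domain_eq:
  assumes "a > 0"
  shows "mtv_domain (2 * a) a n = (\<Union>M. map (node a) ` dec_lists M n)"
proof (intro equalityI subsetI)
  have less: "node a i > node a j \<longleftrightarrow> i > j" for i j
    using assms by (simp add: node_def)
  fix ms
  {
    assume "ms \<in> (\<Union>M. map (node a) ` dec_lists M n)"
    then obtain js where "ms = map (node a) js" "length js = n" "sorted_wrt (>) js"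
      by (auto simp: dec_lists_def)
    then show "ms \<in> mtv_domain (2 * a) a n"
      using cong_node_iff[OF assms] by (auto simp: mtv_domain_def sorted_wrt_map less)
  }
  assume ms: "ms \<in> mtv_domain (2 * a) a n"
  then have "set ms \<subseteq> range (node a)"
    using cong_node_iff[OF assms] by (auto simp: mtv_domain_def)
  then obtain js where js: "ms = map (node a) js"
    by (metis ex_map_conv image_iff subset_iff)
  have "js \<in> dec_lists (Suc (Max (insert 0 (set js)))) n"
    using ms by (auto simp: js dec_lists_def mtv_domain_def sorted_wrt_map less less_Suc_eq_le)
  then show "ms \<in> (\<Union>M. map (node a) ` dec_lists M n)" using js by blast
qed

lemma dec_lists_mono: "M \<le> M' \<Longrightarrow> dec_lists M n \<subseteq> dec_lists M' n"
  by (auto simp: dec_lists_def)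

lemma inj_node: "a > 0 \<Longrightarrow> inj (map (node a))"
  by (intro inj_mapI) (auto simp: inj_def node_def)

text \<open>All terms are nonnegative, so bounded truncations give summability, and the sums over
  the exhausting sets \<open>D M\<close> converge to the \<open>infsum\<close>.\<close>

lemma trunc_tendsto_mtv:
  assumes a: "a > 0" and bdd: "\<And>M. trunc (\<lambda>j. real a * odd_num j) ks M \<le> B"
  shows "(\<lambda>M. trunc (\<lambda>j. real a * odd_num j) ks M) \<longlonglongrightarrow> mtv (2 * a) a ks"
proof -
  define f where "f ms = 1 / (\<Prod>i<dep ks. real (ms ! i) ^ (ks ! i))" for ms
  define D where "D M = map (node a) ` dec_lists M (dep ks)" for M
  let ?A = "mtv_domain (2 * a) a (dep ks)"
  have A: "?A = (\<Union>M. D M)" unfolding D_def by (rule mtv_domain_eq[OF a])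
  have D_mono: "M \<le> M' \<Longrightarrow> D M \<subseteq> D M'" for M M'
    unfolding D_def by (intro image_mono dec_lists_mono)
  have fin: "finite (D M)" for M by (simp add: D_def)
  have sumD: "sum f (D M) = trunc (\<lambda>j. real a * odd_num j) ks M" for M
  proof -
    have "sum f (D M) = (\<Sum>js\<in>dec_lists M (dep ks). f (map (node a) js))"
      unfolding D_def using inj_node[OF a] by (subst sum.reindex) (auto simp: inj_on_def)
    also have "\<dots> = (\<Sum>js\<in>dec_lists M (dep ks). 1 / (\<Prod>i<dep ks. (real a * odd_num (js ! i)) ^ (ks ! i)))"
    proof (intro sum.cong refl)
      fix js assume "js \<in> dec_lists M (dep ks)"
      then have "length js = dep ks" by (simp add: dec_lists_def)
      then show "f (map (node a) js) = 1 / (\<Prod>i<dep ks. (real a * odd_num (js ! i)) ^ (ks ! i))"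
        by (simp add: f_def node_def distrib_left add.commute)
    qed
    also have "\<dots> = trunc (\<lambda>j. real a * odd_num j) ks M" by (rule sum_dec_lists)
    finally show ?thesis .
  qed
  have f_nonneg: "f ms \<ge> 0" for ms by (simp add: f_def prod_nonneg)
  have exhaust: "\<exists>M. F \<subseteq> D M" if "finite F" "F \<subseteq> ?A" for F
    using that
  proof (induction F rule: finite_induct)
    case (insert x F)
    then obtain M M' where "F \<subseteq> D M" "x \<in> D M'" unfolding A by auto
    then have "insert x F \<subseteq> D (max M M')"
      using D_mono[of M "max M M'"] D_mono[of M' "max M M'"] by auto
    then show ?case by blast
  qed simp
  have "f summable_on ?A"
  proof (rule nonneg_bdd_above_summable_on)
    show "bdd_above (sum f ` {F. F \<subseteq> ?A \<and> finite F})"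
    proof (rule bdd_aboveI2)
      fix F assume "F \<in> {F. F \<subseteq> ?A \<and> finite F}"
      then obtain M where "F \<subseteq> D M" using exhaust[of F] by blast
      then have "sum f F \<le> sum f (D M)" by (intro sum_mono2 fin f_nonneg)
      then show "sum f F \<le> B" using bdd[of M] sumD by simp
    qed
  qed (rule f_nonneg)
  then have "(f has_sum mtv (2 * a) a ks) ?A"
    unfolding mtv_def f_def by (rule has_sum_infsum)
  then have lim: "(sum f \<longlongrightarrow> mtv (2 * a) a ks) (finite_subsets_at_top ?A)"
    by (simp add: has_sum_def)
  \<comment> \<open>The limit over the net of finite subsets is read off along the sequence
    \<open>D\<close>.\<close>
  have "filterlim D (finite_subsets_at_top ?A) sequentially"
    unfolding filterlim_finite_subsets_at_top
  proof (intro allI impI)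
    fix X assume "finite X \<and> X \<subseteq> ?A"
    then obtain M where "X \<subseteq> D M" using exhaust by blast
    then show "eventually (\<lambda>M. finite (D M) \<and> X \<subseteq> D M \<and> D M \<subseteq> ?A) sequentially"
      unfolding eventually_sequentially A using fin D_mono by (intro exI[of _ M]) blast
  qed
  from filterlim_compose[OF lim this] show ?thesis by (simp add: sumD)
qed

section \<open>Convergence for admissible indices and for interpolated values\<close>

lemma itrunc_scale: "itrunc (\<lambda>j. c * u j) \<rho> ks M = itrunc u \<rho> ks M / c ^ weight ks"
proof -
  have "(\<Sum>p\<leftarrow>ps. \<rho> ^ (d - dep p) * trunc (\<lambda>j. c * u j) p M)
      = (\<Sum>p\<leftarrow>ps. \<rho> ^ (d - dep p) * trunc u p M) / c ^ w"
    if "\<And>p. p \<in> set ps \<Longrightarrow> weight p = w" for ps d w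
    using that by (induction ps) (simp_all add: trunc_scale add_divide_distrib)
  then show ?thesis unfolding itrunc_def using box_choices_weight by blast
qed

lemma self_in_box_choices: "ks \<in> set (box_choices ks)"
  by (induction ks rule: box_choices.induct) auto

text \<open>Since \<open>0 ^ 0 = 1\<close>, the choice with commas only contributes
  \<open>trunc u ks M\<close>, and no other choice contributes a negative amount.\<close>

lemma trunc_le_itrunc_0:
  assumes "\<And>j. u j > 0"
  shows "trunc u ks M \<le> itrunc u 0 ks M"
proof -
  have "f x \<le> (\<Sum>y\<leftarrow>xs. f y)" if "x \<in> set xs" "\<And>y. f y \<ge> 0" for x xs and f :: "nat list \<Rightarrow> real"
    using that
  proof (induction xs)
    case (Cons y xs)
    have "0 \<le> (\<Sum>y\<leftarrow>xs. f y)" using Cons.prems(2) by (intro sum_list_nonneg) auto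
    then show ?case using Cons by (auto intro: add_increasing)
  qed simp
  from this[OF self_in_box_choices, of "\<lambda>p. 0 ^ (dep ks - dep p) * trunc u p M" ks]
  show ?thesis using trunc_nonneg[OF assms] by (simp add: itrunc_def)
qed

lemma odd_num_neq_0: "odd_num j \<noteq> 0"
  by (simp add: add_nonneg_eq_0_iff)

text \<open>Convergence comes from the generating function itself: at \<rho> = 0 the truncated sum
  occurs, with weight at least 1, among the nonnegative summands of \<open>truncated_sum\<close>, so
  it is below a coefficient of \<open>gfps_lim\<close>.\<close>

lemma trunc_bounded:
  assumes "admissible ks"
  obtains B where "\<And>M. trunc odd_num ks M \<le> B"
proof
  fix M
  obtain q qs where ks: "ks = q # qs" "q \<ge> 2" "is_index qs"
    using assms by (cases ks) (auto simp: admissible_def is_index_def)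
  define w where "w = q + weight qs - 2"
  have w: "w + 2 = q + weight qs" using ks by (simp add: w_def)
  have nn: "0 \<le> wgt 1 xs * itrunc odd_num 0 ys M" for xs ys
    using trunc_le_itrunc_0[of odd_num ys M] trunc_nonneg[of odd_num ys M]
    by (intro mult_nonneg_nonneg) (auto simp: wgt_def intro!: prod_list_nonneg)
  have "trunc odd_num ks M \<le> 1 * itrunc odd_num 0 ks M"
    using trunc_le_itrunc_0[of odd_num ks M] by simp
  \<comment> \<open>By \<open>wgt_eq\<close> the weight at \<sigma> = 1 is a power of 2.\<close>
  also have "\<dots> \<le> wgt 1 qs * itrunc odd_num 0 ks M"
    using wgt_eq[OF ks(3), of 1] trunc_le_itrunc_0[of odd_num ks M] trunc_nonneg[of odd_num ks M]
    by (intro mult_right_mono) auto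
  also have "\<dots> \<le> (\<Sum>xs\<in>compositions (w + 2 - q). wgt 1 xs * itrunc odd_num 0 (q # xs) M)"
  proof -
    have "qs \<in> compositions (w + 2 - q)" using ks w by (simp add: compositions_def)
    then show ?thesis
      unfolding ks(1) by (rule member_le_sum[of qs _ "\<lambda>xs. wgt 1 xs * itrunc odd_num 0 (q # xs) M"]) (auto intro: nn)
  qed
  also have "\<dots> \<le> (\<Sum>k=2..w+2. \<Sum>xs\<in>compositions (w + 2 - k). wgt 1 xs * itrunc odd_num 0 (k # xs) M)"
    using ks w nn by (intro member_le_sum[of q "{2..w+2}"] sum_nonneg) auto
  also have "\<dots> = gfps odd_num M $ w"
    using truncated_sum[where u = odd_num and \<rho> = 0 and w = w and M = M, OF odd_num_neq_0] by simp
  also have "\<dots> \<le> gfps_lim $ w" by (rule gfps_le_gfps_lim)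
  finally show "trunc odd_num ks M \<le> gfps_lim $ (weight ks - 2)" by (simp add: ks w_def)
qed

lemma trunc_tendsto:
  assumes "a > 0" "admissible ks"
  shows "(\<lambda>M. trunc (\<lambda>j. real a * odd_num j) ks M) \<longlonglongrightarrow> mtv (2 * a) a ks"
proof -
  obtain B where B: "\<And>M. trunc odd_num ks M \<le> B" using trunc_bounded assms(2) by blast
  have "trunc (\<lambda>j. real a * odd_num j) ks M \<le> B / real a ^ weight ks" for M
    using assms(1) B by (simp add: trunc_scale divide_right_mono)
  then show ?thesis by (rule trunc_tendsto_mtv[OF assms(1)])
qed

lemma poly_imtv_tendsto:
  assumes "a > 0" "admissible ks"
  shows "(\<lambda>M. itrunc (\<lambda>j. real a * odd_num j) \<rho> ks M) \<longlonglongrightarrow> poly (imtv (2 * a) a ks) \<rho>"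
proof -
  have "(\<lambda>M. \<Sum>p\<leftarrow>ps. \<rho> ^ (d - dep p) * trunc (\<lambda>j. real a * odd_num j) p M)
      \<longlonglongrightarrow> poly (\<Sum>p\<leftarrow>ps. monom (mtv (2 * a) a p) (d - dep p)) \<rho>"
    if "\<And>p. p \<in> set ps \<Longrightarrow> admissible p" for ps d
    using that
  proof (induction ps)
    case (Cons p ps)
    have "(\<lambda>M. \<rho> ^ (d - dep p) * trunc (\<lambda>j. real a * odd_num j) p M
          + (\<Sum>p\<leftarrow>ps. \<rho> ^ (d - dep p) * trunc (\<lambda>j. real a * odd_num j) p M))
      \<longlonglongrightarrow> \<rho> ^ (d - dep p) * mtv (2 * a) a p
          + poly (\<Sum>p\<leftarrow>ps. monom (mtv (2 * a) a p) (d - dep p)) \<rho>"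
      using Cons by (intro tendsto_intros trunc_tendsto assms) auto
    then show ?case by (simp add: poly_monom mult.commute)
  qed simp
  then show ?thesis
    unfolding itrunc_def imtv_def using box_choices_admissible[OF assms(2)] by blast
qed

section \<open>The left-hand side as a coefficient of \<open>gfps_lim\<close>\<close>

lemma sum_I0:
  assumes "k \<ge> 2"
  shows "(\<Sum>n=1..k-1. \<sigma> ^ (k - n - 1) * 2 ^ (n - 1) * (\<Sum>ks\<in>I0 k n. h ks))
    = (\<Sum>q=2..k. \<sigma> ^ (q - 2) * (\<Sum>ks\<in>compositions (k - q). wgt \<sigma> ks * h (q # ks)))"
proof -
  define g where "g ks = \<sigma> ^ (k - dep ks - 1) * 2 ^ (dep ks - 1) * h ks" for ks
  have fin: "finite (I0 k n)" for n
    by (rule finite_subset[OF _ finite_compositions[of k]])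
       (auto simp: I0_def compositions_def admissible_def)
  have "(\<Sum>n=1..k-1. \<sigma> ^ (k - n - 1) * 2 ^ (n - 1) * (\<Sum>ks\<in>I0 k n. h ks))
      = (\<Sum>n=1..k-1. \<Sum>ks\<in>I0 k n. g ks)"
    by (intro sum.cong refl) (auto simp: sum_distrib_left g_def I0_def intro!: sum.cong)
  also have "\<dots> = (\<Sum>ks\<in>(\<Union>n\<in>{1..k-1}. I0 k n). g ks)"
    using fin by (intro sum.UNION_disjoint[symmetric]) (auto simp: I0_def)
  also have "(\<Union>n\<in>{1..k-1}. I0 k n) = (\<Union>q\<in>{2..k}. (#) q ` compositions (k - q))"
  proof (intro equalityI subsetI)
    fix ks assume "ks \<in> (\<Union>n\<in>{1..k-1}. I0 k n)"
    then show "ks \<in> (\<Union>q\<in>{2..k}. (#) q ` compositions (k - q))"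
      by (cases ks) (auto simp: I0_def admissible_def compositions_def is_index_def image_iff)
  next
    fix ks assume "ks \<in> (\<Union>q\<in>{2..k}. (#) q ` compositions (k - q))"
    then obtain q xs where xs: "ks = q # xs" "2 \<le> q" "q \<le> k" "is_index xs" "weight xs = k - q"
      by (auto simp: compositions_def)
    \<comment> \<open>With first entry at least 2, the depth is at most \<open>k - 1\<close>, so the
      range of n covers all admissible indices of weight \<open>k\<close>.\<close>
    then have "dep xs \<le> k - q" using length_le_weight[of xs] by simp
    then show "ks \<in> (\<Union>n\<in>{1..k-1}. I0 k n)"
      using xs by (auto simp: I0_def admissible_def is_index_def)
  qed
  also have "sum g \<dots> = (\<Sum>q=2..k. \<Sum>ks\<in>compositions (k - q). g (q # ks))"
    by (rule sum_UN_Cons) auto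
  also have "\<dots> = (\<Sum>q=2..k. \<sigma> ^ (q - 2) * (\<Sum>ks\<in>compositions (k - q). wgt \<sigma> ks * h (q # ks)))"
    unfolding sum_distrib_left
  proof (intro sum.cong refl)
    fix q ks assume q: "q \<in> {2..k}" and ks: "ks \<in> compositions (k - q)"
    then have "is_index ks" "weight ks = k - q" "dep ks \<le> k - q"
      using length_le_weight[of ks] by (auto simp: compositions_def)
    \<comment> \<open>The exponent of \<sigma> splits into \<open>q - 2\<close> from the first entry
      and the excess of weight over depth of the rest, which is what \<open>wgt\<close>
      records.\<close>
    moreover from this q have "k - dep (q # ks) - 1 = (q - 2) + (k - q - dep ks)" by auto
    ultimately show "g (q # ks) = \<sigma> ^ (q - 2) * (wgt \<sigma> ks * h (q # ks))"
      by (simp add: g_def wgt_eq power_add)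
  qed
  finally show ?thesis .
qed

text \<open>For every truncation the left-hand side is a coefficient of
  \<open>gfps odd_num M\<close>, divided by \<open>a ^ k\<close> since all indices have weight
  \<open>k\<close>. Letting \<open>M\<close> grow gives the claim.\<close>

lemma poly_lhs:
  assumes a: "a > 0" and k: "k \<ge> 2"
  shows "(\<Sum>n=1..k-1. (1 - 2 * \<rho>) ^ (k - n - 1) * 2 ^ (n - 1) * (\<Sum>ks\<in>I0 k n. poly (imtv (2 * a) a ks) \<rho>))
         = gfps_lim $ (k - 2) / real a ^ k"
proof (rule LIMSEQ_unique)
  let ?L = "\<lambda>M. \<Sum>n=1..k-1. (1 - 2 * \<rho>) ^ (k - n - 1) * 2 ^ (n - 1) *
      (\<Sum>ks\<in>I0 k n. itrunc (\<lambda>j. real a * odd_num j) \<rho> ks M)"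
  show "?L \<longlonglongrightarrow> (\<Sum>n=1..k-1. (1 - 2 * \<rho>) ^ (k - n - 1) * 2 ^ (n - 1) * (\<Sum>ks\<in>I0 k n. poly (imtv (2 * a) a ks) \<rho>))"
    using a by (intro tendsto_intros poly_imtv_tendsto) (auto simp: I0_def)
  have "?L M = gfps odd_num M $ (k - 2) / real a ^ k" for M
  proof -
    have "?L M = (\<Sum>n=1..k-1. (1 - 2 * \<rho>) ^ (k - n - 1) * 2 ^ (n - 1) *
        (\<Sum>ks\<in>I0 k n. itrunc odd_num \<rho> ks M / real a ^ k))"
      by (intro sum.cong refl arg_cong2[of _ _ _ _ "(*)"]) (auto simp: itrunc_scale I0_def)
    also have "\<dots> = (\<Sum>n=1..k-1. (1 - 2 * \<rho>) ^ (k - n - 1) * 2 ^ (n - 1) *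
        (\<Sum>ks\<in>I0 k n. itrunc odd_num \<rho> ks M)) / real a ^ k"
      by (simp flip: sum_divide_distrib)
    also have "(\<Sum>n=1..k-1. (1 - 2 * \<rho>) ^ (k - n - 1) * 2 ^ (n - 1) * (\<Sum>ks\<in>I0 k n. itrunc odd_num \<rho> ks M))
        = gfps odd_num M $ (k - 2)"
      using truncated_sum[where u = odd_num and \<rho> = \<rho> and w = "k - 2" and M = M, OF odd_num_neq_0]
      unfolding sum_I0[OF k] le_add_diff_inverse2[OF k] .
    finally show ?thesis .
  qed
  then show "?L \<longlonglongrightarrow> gfps_lim $ (k - 2) / real a ^ k"
    using a by (auto intro!: tendsto_intros gfps_tendsto)
qed

section \<open>The eta values in terms of t-values and log 2\<close>

lemma tval_tendsto:
  assumes "n \<ge> 2"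
  shows "(\<lambda>M. \<Sum>j<M. 1 / odd_num j ^ n) \<longlonglongrightarrow> tval n"
  using trunc_tendsto[of 1 "[n]"] assms by (simp add: admissible_def is_index_def tval_def)

lemma eta_1: "eta (Suc 0) = ln 2"
proof (rule LIMSEQ_unique[OF eta_part_tendsto])
  have "eta_part p (Suc 0) = (\<Sum>k<2*p. (-1) ^ k / real (Suc k))" for p
    by (induction p) (simp_all add: eta_part_def add.commute)
  moreover have "(\<lambda>p. \<Sum>k<2*p. (-1) ^ k / real (Suc k)) \<longlonglongrightarrow> ln 2"
    using LIMSEQ_subseq_LIMSEQ[OF alternating_harmonic_series_sums[unfolded sums_def], of "\<lambda>p. 2 * p"]
    by (simp add: strict_mono_def o_def)
  ultimately show "(\<lambda>p. eta_part p (Suc 0)) \<longlonglongrightarrow> ln 2" by simp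
qed

text \<open>Let E be the sum over the even numbers, so that \<open>eta n = tval n - E\<close>. The
  even numbers are the doubles of all positive integers, which gives
  \<open>2 ^ n * E = tval n + E\<close> and determines E.\<close>

lemma eta_eq_tval:
  assumes n: "n \<ge> 2"
  shows "eta n = tval n * (2 ^ n - 2) / (2 ^ n - 1)"
proof -
  define E where "E p = (\<Sum>i<p. 1 / (2 * real i + 2) ^ n)" for p
  define T where "T p = (\<Sum>i<p. 1 / odd_num i ^ n)" for p
  have T: "T \<longlonglongrightarrow> tval n" unfolding T_def using tval_tendsto[OF n] .
  have "E = (\<lambda>p. T p - eta_part p n)" by (simp add: fun_eq_iff E_def T_def eta_part_def sum_subtractf)
  then have E: "E \<longlonglongrightarrow> tval n - eta n" using tendsto_diff[OF T eta_part_tendsto] by simp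
  \<comment> \<open>The first \<open>2 * p\<close> even numbers are the doubles of the first
    \<open>p\<close> odd and the first \<open>p\<close> even numbers.\<close>
  have double: "E (2 * p) = (T p + E p) / 2 ^ n" for p
  proof (induction p)
    case (Suc p)
    have "E (2 * Suc p) = E (2 * p) + 1 / (2 * odd_num p) ^ n + 1 / (2 * (2 * real p + 2)) ^ n"
      by (simp add: E_def algebra_simps)
    then show ?case unfolding Suc power_mult_distrib by (simp add: E_def T_def add_divide_distrib mult.commute)
  qed (simp add: E_def T_def)
  have "(\<lambda>p. E (2 * p)) \<longlonglongrightarrow> tval n - eta n"
    using LIMSEQ_subseq_LIMSEQ[OF E, of "\<lambda>p. 2 * p"] by (simp add: strict_mono_def o_def)
  moreover have "(\<lambda>p. E (2 * p)) \<longlonglongrightarrow> (tval n + (tval n - eta n)) / 2 ^ n"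
    unfolding double by (intro tendsto_intros T E) auto
  ultimately have "tval n - eta n = (tval n + (tval n - eta n)) / 2 ^ n"
    by (rule LIMSEQ_unique)
  moreover have "(2::real) ^ n > 1" using n by (intro one_less_power) auto
  ultimately show ?thesis by (simp add: field_simps)
qed

lemma odd_series_0: "odd_series 0 = tval 2"
proof -
  have "odd_prod 0 j = 1" for j
    unfolding odd_prod_def by (intro prod.neutral) (auto simp: add_nonneg_eq_0_iff)
  then have "odd_term 0 = (\<lambda>j. 1 / odd_num j ^ 2)" by (simp add: fun_eq_iff odd_term_def power2_eq_square)
  then show ?thesis
    unfolding odd_series_def using summable_LIMSEQ[OF summable_odd_num_squares] tval_tendsto[of 2] LIMSEQ_unique by force
qed

section \<open>Expansion of the exponential into tuples\<close>

definition eta_coeff :: "nat \<Rightarrow> real" where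
  "eta_coeff n = 4 * (2 ^ (n - 1) - 1) * tval n / (real n * (2 ^ n - 1))"

text \<open>The linear term of \<open>eta_series\<close> is kept apart: its coefficient is
  \<open>2 * ln 2\<close> instead of a t-value and produces the powers of log 2.\<close>

definition eta_tail :: "real fps" where
  "eta_tail = Abs_fps (\<lambda>n. if n < 2 then 0 else eta_coeff n)"

lemma eta_series_eq: "eta_series = fps_const (2 * ln 2) * fps_X + eta_tail"
proof (rule fps_ext)
  fix n :: nat
  consider "n = 0" | "n = 1" | "n \<ge> 2" by linarith
  then show "eta_series $ n = (fps_const (2 * ln 2) * fps_X + eta_tail) $ n"
  proof cases
    case 3
    then have "(2::real) ^ n = 2 * 2 ^ (n - 1)" by (cases n) auto
    then have "(2::real) ^ n - 2 = 2 * (2 ^ (n - 1) - 1)" by simp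
    then show ?thesis using 3
      by (simp add: eta_series_def eta_tail_def eta_coeff_def eta_eq_tval fps_X_def mult_ac)
  qed (simp_all add: eta_series_def eta_tail_def eta_1)
qed

text \<open>The right-hand side has logarithmic derivative \<open>fps_deriv eta_series\<close> and
  the initial value t(2), as \<open>gfps_lim\<close> does.\<close>

lemma gfps_lim_eq: "gfps_lim = fps_const (tval 2) * (fps_exp (2 * ln 2) * (fps_exp 1 oo eta_tail))"
proof (rule fps_ode_unique[OF gfps_lim_ode])
  have [simp]: "eta_tail $ 0 = 0" by (simp add: eta_tail_def)
  show "gfps_lim $ 0 = (fps_const (tval 2) * (fps_exp (2 * ln 2) * (fps_exp 1 oo eta_tail))) $ 0"
    by (simp add: gfps_lim_0 odd_series_0)
  have "fps_deriv (fps_exp 1 oo eta_tail) = (fps_exp 1 oo eta_tail) * fps_deriv eta_tail"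
    by (simp add: fps_compose_deriv)
  moreover have "fps_deriv eta_series = fps_const (2 * ln 2) + fps_deriv eta_tail"
    by (simp add: eta_series_eq)
  ultimately show "fps_deriv (fps_const (tval 2) * (fps_exp (2 * ln 2) * (fps_exp 1 oo eta_tail)))
      = fps_deriv eta_series * (fps_const (tval 2) * (fps_exp (2 * ln 2) * (fps_exp 1 oo eta_tail)))"
    by (simp add: algebra_simps)
qed

definition parts :: "nat \<Rightarrow> nat \<Rightarrow> nat list set" where
  "parts m v = {ns. length ns = m \<and> (\<forall>i\<in>set ns. i \<ge> 2) \<and> sum_list ns = v}"

lemma eta_tail_power_nth: "(eta_tail ^ m) $ v = (\<Sum>ns\<in>parts m v. \<Prod>i\<leftarrow>ns. eta_coeff i)"
proof -
  have "(eta_tail ^ m) $ v = (\<Sum>ns\<in>natpermute v m. \<Prod>i\<leftarrow>ns. eta_tail $ i)"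
  proof (cases m)
    case 0
    moreover have "natpermute v 0 = (if v = 0 then {[]} else {})"
      by (auto simp: natpermute_def)
    ultimately show ?thesis by simp
  next
    case (Suc m')
    have "(\<Prod>i\<leftarrow>ns. eta_tail $ i) = (\<Prod>j=0..m'. eta_tail $ (ns ! j))" if "length ns = m" for ns
      using that Suc by (simp add: prod.list_conv_set_nth atLeast0LessThan lessThan_Suc_atMost atLeast0AtMost)
    then show ?thesis
      unfolding fps_power_nth using Suc by (auto simp: natpermute_def intro!: sum.cong)
  qed
  \<comment> \<open>Tuples with an entry 0 or 1 drop out, because \<open>eta_tail\<close> vanishes
    there.\<close>
  also have "\<dots> = (\<Sum>ns\<in>parts m v. \<Prod>i\<leftarrow>ns. eta_tail $ i)"
  proof (rule sum.mono_neutral_right)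
    show "finite (natpermute v m)" by (rule natpermute_finite)
    show "parts m v \<subseteq> natpermute v m" by (auto simp: parts_def natpermute_def)
    show "\<forall>ns\<in>natpermute v m - parts m v. (\<Prod>i\<leftarrow>ns. eta_tail $ i) = 0"
      by (auto simp: parts_def natpermute_def prod_list_zero_iff eta_tail_def)
  qed
  also have "\<dots> = (\<Sum>ns\<in>parts m v. \<Prod>i\<leftarrow>ns. eta_coeff i)"
    by (intro sum.cong refl arg_cong[of _ _ prod_list] map_cong) (auto simp: parts_def eta_tail_def)
  finally show ?thesis .
qed

lemma finite_parts: "finite (parts m v)"
  by (rule finite_subset[OF _ natpermute_finite[of v m]]) (auto simp: parts_def natpermute_def)

text \<open>Entries of at least 2 force \<open>m \<le> w - n\<close>, the range of exponents in the
  coefficient formula for a composition. In particular the index set is finite.\<close>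

lemma rhs_tuples_eq: "rhs_tuples w = Sigma {0..w} (\<lambda>n. Sigma {0..w - n} (\<lambda>m. parts m (w - n)))"
proof -
  have "length ns \<le> sum_list ns" if "\<forall>i\<in>set ns. i \<ge> 2" for ns :: "nat list"
    using that by (induction ns) auto
  then show ?thesis by (force simp: rhs_tuples_def parts_def)
qed

lemma gfps_lim_nth:
  "gfps_lim $ w = (\<Sum>(n, m, ns)\<in>rhs_tuples w.
     tval 2 * ((2 * ln 2) ^ n / fact n * (1 / fact m * (\<Prod>i\<leftarrow>ns. eta_coeff i))))"
proof -
  have "gfps_lim $ w = (\<Sum>n=0..w. \<Sum>m=0..w-n. \<Sum>ns\<in>parts m (w - n). 
     tval 2 * ((2 * ln 2) ^ n / fact n * (1 / fact m * (\<Prod>i\<leftarrow>ns. eta_coeff i))))"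
    by (simp add: gfps_lim_eq fps_mult_nth[of "fps_exp _"] fps_compose_nth eta_tail_power_nth sum_distrib_left)
  also have "\<dots> = (\<Sum>(n, m, ns)\<in>rhs_tuples w.
     tval 2 * ((2 * ln 2) ^ n / fact n * (1 / fact m * (\<Prod>i\<leftarrow>ns. eta_coeff i))))"
    unfolding rhs_tuples_eq using finite_parts by (simp add: sum.Sigma split_beta)
  finally show ?thesis .
qed

lemma prod_eta_coeff: "(\<Prod>i\<leftarrow>ns. eta_coeff i) = 2 ^ (2 * length ns) * (\<Prod>i\<leftarrow>ns. 2 ^ (i - 1) - 1) * (\<Prod>i\<leftarrow>ns. tval i)
    / ((\<Prod>i\<leftarrow>ns. real i) * (\<Prod>i\<leftarrow>ns. 2 ^ i - 1))"
  by (induction ns) (simp_all add: eta_coeff_def mult_ac)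

section \<open>Comparison as polynomials in the variable \<open>r\<close>\<close>

theorem corollary3p4:
  fixes a k :: nat and r :: "real poly"
  assumes "a > 0" and "k \<ge> 2" and "r = monom 1 1"
  shows "(\<Sum>n=1..k-1. (1 - 2 * r) ^ (k - n - 1) * 2 ^ (n - 1)
            * (\<Sum>ks\<in>I0 k n. imtv (2 * a) a ks))
       = [: \<Sum>(n, m, ns)\<in>rhs_tuples (k - 2).
              2 ^ (n + 2 * m) * (\<Prod>i\<leftarrow>ns. 2 ^ (i - 1) - 1)
              / (real a ^ k * fact n * fact m * (\<Prod>i\<leftarrow>ns. real i) * (\<Prod>i\<leftarrow>ns. 2 ^ i - 1))
              * tval 2 * (\<Prod>i\<leftarrow>ns. tval i) * ln 2 ^ n :]"
    (is "?L = [: ?R :]")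
proof -
  have "?R = gfps_lim $ (k - 2) / real a ^ k"
    unfolding gfps_lim_nth sum_divide_distrib
  proof (intro sum.cong refl, clarify)
    fix n m ns assume "(n, m, ns) \<in> rhs_tuples (k - 2)"
    then have m: "length ns = m" by (simp add: rhs_tuples_def)
    show "2 ^ (n + 2 * m) * (\<Prod>i\<leftarrow>ns. 2 ^ (i - 1) - 1)
              / (real a ^ k * fact n * fact m * (\<Prod>i\<leftarrow>ns. real i) * (\<Prod>i\<leftarrow>ns. 2 ^ i - 1))
              * tval 2 * (\<Prod>i\<leftarrow>ns. tval i) * ln 2 ^ n
        = tval 2 * ((2 * ln 2) ^ n / fact n * (1 / fact m * (\<Prod>i\<leftarrow>ns. eta_coeff i))) / real a ^ k"
      unfolding prod_eta_coeff m by (simp add: power_add power_mult_distrib mult_ac)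
  qed
  \<comment> \<open>The value is the same at every real \<rho>, so the left-hand side is a constant
    polynomial: real polynomials with equal values everywhere coincide.\<close>
  moreover have "poly ?L \<rho> = gfps_lim $ (k - 2) / real a ^ k" for \<rho>
  proof -
    have "poly ?L \<rho> = (\<Sum>n=1..k-1. (1 - 2 * \<rho>) ^ (k - n - 1) * 2 ^ (n - 1) *
        (\<Sum>ks\<in>I0 k n. poly (imtv (2 * a) a ks) \<rho>))"
      by (simp add: poly_sum poly_monom assms(3))
    then show ?thesis using poly_lhs[OF assms(1,2)] by simp
  qed
  ultimately have "poly ?L = poly [: ?R :]" by (simp add: fun_eq_iff)
  then show ?thesis by (simp only: poly_eq_poly_eq_iff)
qed

end
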